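(* Let $C$ be a commutative domain with identity. If $n\geq 3$, then each Lie biderivation of a (block) upper triangular matrix algebra $B^{\bar{k}}_n(C)$ is the sum of an extremal biderivation and an inner biderivation. In particular, every biderivation of the upper triangular matrix algebra $T_n(C)$ is the sum of an extremal biderivation, an inner biderivation and a central mapping.
   Context: For $\bar{k}=(k_1,\dots,k_m)$ a vector of positive integers with $k_1+\cdots+k_m=n$, $B^{\bar{k}}_n(C)$ is the subalgebra of the full matrix algebra $M_n(C)$ consisting of all block upper triangular matrices with diagonal blocks of sizes $k_1,\dots,k_m$ (blocks below the diagonal are zero, all other entries are arbitrary in $C$). $T_n(C)$ is the algebra of all upper triangular $n\times n$ matrices over $C$. Write $[x,y]=xy-yx$, and let $\mathcal{Z}(\mathcal{A})$ be the center of an algebra $\mathcal{A}$. Let $\mathcal{A}$ be an associative $C$-algebra. A Lie biderivation of $\mathcal{A}$ is a $C$-bilinear map $\varphi:\mathcal{A}\times\mathcal{A}\to\mathcal{A}$ with $\varphi([x,z],y)=[\varphi(x,y),z]+[x,\varphi(z,y)]$ and $\varphi(x,[y,z])=[\varphi(x,y),z]+[y,\varphi(x,z)]$ for all $x,y,z\in\mathcal{A}$. A biderivation of $\mathcal{A}$ is a $C$-bilinear map $\mathcal{A}\times\mathcal{A}\to\mathcal{A}$ that is a derivation in each argument. For noncommutative $\mathcal{A}$, an inner biderivation is a map of the form $(x,y)\mapsto\lambda[x,y]$ with $\lambda\in\mathcal{Z}(\mathcal{A})$. An extremal biderivation is a $C$-bilinear map of the form $(x,y)\mapsto[x,[y,a]]$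 with $a\in\mathcal{A}$, $a\notin\mathcal{Z}(\mathcal{A})$. A central mapping is a bilinear map $\mathcal{A}\times\mathcal{A}\to\mathcal{Z}(\mathcal{A})$.
   Formalization: A central mapping is added to the sum for Lie biderivations (without it x_11·y_11·I on T_3 is a counterexample), and in both sentences the extremal biderivation may be replaced by zero (otherwise the zero map has no decomposition). *)

theory Defs
  imports "Jordan_Normal_Form.Matrix"
begin

text \<open>
  Algebras are given by their carrier sets \<open>S\<close> of square matrices of one fixed size over a
  commutative ring. A map on such an algebra is a HOL function on all matrices of which only the
  values at arguments in \<open>S\<close> matter.
\<close>

definition lie_bracket :: "'a::comm_ring_1 mat \<Rightarrow> 'a mat \<Rightarrow> 'a mat" where
  "lie_bracket x y = x * y - y * x"

definition center :: "'a::comm_ring_1 mat set \<Rightarrow> 'a mat set" where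
  "center S = {z \<in> S. \<forall>x\<in>S. z * x = x * z}"

definition linear_between ::
  "'a::comm_ring_1 mat set \<Rightarrow> 'a mat set \<Rightarrow> ('a mat \<Rightarrow> 'a mat) \<Rightarrow> bool" where
  "linear_between S T f \<longleftrightarrow>
     (\<forall>x\<in>S. f x \<in> T) \<and>
     (\<forall>x\<in>S. \<forall>y\<in>S. f (x + y) = f x + f y) \<and>
     (\<forall>c. \<forall>x\<in>S. f (c \<cdot>\<^sub>m x) = c \<cdot>\<^sub>m f x)"

definition bilinear_between ::
  "'a::comm_ring_1 mat set \<Rightarrow> 'a mat set \<Rightarrow> ('a mat \<Rightarrow> 'a mat \<Rightarrow> 'a mat) \<Rightarrow> bool" where
  "bilinear_between S T \<phi> \<longleftrightarrow>
     (\<forall>y\<in>S. linear_between S T (\<lambda>x. \<phi> x y)) \<and>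
     (\<forall>x\<in>S. linear_between S T (\<lambda>y. \<phi> x y))"

definition derivation :: "'a::comm_ring_1 mat set \<Rightarrow> ('a mat \<Rightarrow> 'a mat) \<Rightarrow> bool" where
  "derivation S d \<longleftrightarrow>
     linear_between S S d \<and> (\<forall>x\<in>S. \<forall>y\<in>S. d (x * y) = d x * y + x * d y)"

definition biderivation ::
  "'a::comm_ring_1 mat set \<Rightarrow> ('a mat \<Rightarrow> 'a mat \<Rightarrow> 'a mat) \<Rightarrow> bool" where
  "biderivation S \<phi> \<longleftrightarrow>
     bilinear_between S S \<phi> \<and>
     (\<forall>y\<in>S. derivation S (\<lambda>x. \<phi> x y)) \<and>
     (\<forall>x\<in>S. derivation S (\<lambda>y. \<phi> x y))"

definition lie_biderivation ::
  "'a::comm_ring_1 mat set \<Rightarrow> ('a mat \<Rightarrow> 'a mat \<Rightarrow> 'a mat) \<Rightarrow> bool" where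
  "lie_biderivation S \<phi> \<longleftrightarrow>
     bilinear_between S S \<phi> \<and>
     (\<forall>x\<in>S. \<forall>y\<in>S. \<forall>z\<in>S.
        \<phi> (lie_bracket x z) y = lie_bracket (\<phi> x y) z + lie_bracket x (\<phi> z y) \<and>
        \<phi> x (lie_bracket y z) = lie_bracket (\<phi> x y) z + lie_bracket y (\<phi> x z))"

definition inner_biderivation ::
  "'a::comm_ring_1 mat set \<Rightarrow> ('a mat \<Rightarrow> 'a mat \<Rightarrow> 'a mat) \<Rightarrow> bool" where
  "inner_biderivation S \<phi> \<longleftrightarrow>
     (\<exists>l\<in>center S. \<forall>x\<in>S. \<forall>y\<in>S. \<phi> x y = l * lie_bracket x y)"

definition extremal_biderivation ::
  "'a::comm_ring_1 mat set \<Rightarrow> ('a mat \<Rightarrow> 'a mat \<Rightarrow> 'a mat) \<Rightarrow> bool" where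
  "extremal_biderivation S \<phi> \<longleftrightarrow>
     bilinear_between S S \<phi> \<and>
     (\<exists>a\<in>S. a \<notin> center S \<and> (\<forall>x\<in>S. \<forall>y\<in>S. \<phi> x y = lie_bracket x (lie_bracket y a)))"

definition central_mapping ::
  "'a::comm_ring_1 mat set \<Rightarrow> ('a mat \<Rightarrow> 'a mat \<Rightarrow> 'a mat) \<Rightarrow> bool" where
  "central_mapping S \<phi> \<longleftrightarrow> bilinear_between S (center S) \<phi>"

text \<open>
  The zero map counts as a degenerate extremal summand. It is not an extremal biderivation in the
  sense above, because \<open>a\<close> is required to be non-central there. Without it the decomposition fails
  already for the zero map on upper triangular matrices.
\<close>

definition extremal_summand ::
  "'a::comm_ring_1 mat set \<Rightarrow> ('a mat \<Rightarrow> 'a mat \<Rightarrow> 'a mat) \<Rightarrow> bool" where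
  "extremal_summand S \<phi> \<longleftrightarrow>
     extremal_biderivation S \<phi> \<or>
     (\<forall>x\<in>S. \<forall>y\<in>S. \<phi> x y = 0\<^sub>m (dim_row x) (dim_col x))"

text \<open>Row and column indices start at 0.\<close>

definition block_indices :: "nat list \<Rightarrow> nat \<Rightarrow> nat set" where
  "block_indices ks r = {sum_list (take r ks)..<sum_list (take (Suc r) ks)}"

definition block_upper_triangular_algebra :: "nat list \<Rightarrow> 'a::comm_ring_1 mat set" where
  "block_upper_triangular_algebra ks =
     {A \<in> carrier_mat (sum_list ks) (sum_list ks).
        \<forall>r<length ks. \<forall>s<r. \<forall>i\<in>block_indices ks r. \<forall>j\<in>block_indices ks s. A $$ (i, j) = 0}"

definition upper_triangular_algebra :: "nat \<Rightarrow> 'a::comm_ring_1 mat set" where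
  "upper_triangular_algebra n = {A \<in> carrier_mat n n. upper_triangular A}"

end

theory Submission
  imports Defs
begin

text \<open>
  For fixed \<open>y\<close> the map \<open>x \<mapsto> \<phi> x y\<close> is a Lie derivation, hence inner up to scalar matrices:
  \<open>\<phi> x y \<equiv> [x, m y]\<close>. Exchanging the arguments gives \<open>\<phi> x y \<equiv> [y, m' x]\<close>. On matrix
  units, with indices \<open>0, \<dots>, N = n - 1\<close>, the identity \<open>[x, m y] \<equiv> [y, m' x]\<close> first forces
  \<open>m E\<^sub>j\<^sub>j \<equiv> c E\<^sub>j\<^sub>j + [E\<^sub>j\<^sub>j, a E\<^sub>0\<^sub>N]\<close> for all \<open>j\<close> with common \<open>c\<close> and \<open>a\<close>, where \<open>a = 0\<close> unless
  the first and the last block have size 1. Since \<open>c y + [y, a E\<^sub>0\<^sub>N]\<close> solves the same identity, one may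
  subtract it and assume \<open>m E\<^sub>j\<^sub>j \<equiv> 0\<close>; then \<open>m\<close> vanishes modulo scalars on all matrix units, because
  \<open>n \<ge> 3\<close> provides a third index.
\<close>

subsection \<open>Lie derivations on matrix units\<close>

text \<open>The \<open>(p, q)\<close> entry of \<open>[E\<^sub>i\<^sub>j, A]\<close>, for a matrix \<open>A\<close> given by its entry function.\<close>

definition unit_bracket :: "nat \<Rightarrow> nat \<Rightarrow> (nat \<Rightarrow> nat \<Rightarrow> 'a::comm_ring_1) \<Rightarrow> nat \<Rightarrow> nat \<Rightarrow> 'a" where
  "unit_bracket i j A p q = (if p = i then A j q else 0) - (if q = j then A p i else 0)"

text \<open>Applied to the entries of a difference, this is congruence modulo scalar matrices.
  Indices from \<open>n\<close> on are unconstrained.\<close>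

definition scalar_entries :: "nat \<Rightarrow> (nat \<Rightarrow> nat \<Rightarrow> 'a::comm_ring_1) \<Rightarrow> bool" where
  "scalar_entries n A \<longleftrightarrow> (\<forall>p<n. \<forall>q<n. p \<noteq> q \<longrightarrow> A p q = 0) \<and> (\<forall>p<n. \<forall>q<n. A p p = A q q)"

lemma scalar_entriesI:
  assumes "\<And>p q. p < n \<Longrightarrow> q < n \<Longrightarrow> p \<noteq> q \<Longrightarrow> A p q = 0"
    and "\<And>p q. p < n \<Longrightarrow> q < n \<Longrightarrow> A p p = A q q"
  shows "scalar_entries n A"
  unfolding scalar_entries_def by (intro conjI allI impI) (use assms in blast)+

lemma scalar_entries_offD: "scalar_entries n A \<Longrightarrow> p < n \<Longrightarrow> q < n \<Longrightarrow> p \<noteq> q \<Longrightarrow> A p q = 0"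
  unfolding scalar_entries_def by blast

lemma scalar_entries_diagD: "scalar_entries n A \<Longrightarrow> p < n \<Longrightarrow> q < n \<Longrightarrow> A p p = A q q"
  unfolding scalar_entries_def by blast

lemma third_index: "3 \<le> n \<Longrightarrow> \<exists>r<n. r \<noteq> a \<and> r \<noteq> (b::nat)"
  by presburger

text \<open>\<open>R i j\<close> says that the entry at \<open>(i, j)\<close> may be nonzero. By
  \<open>le_R\<close> all upper triangular positions are allowed, and \<open>trans_R\<close> closes
  the pattern under products, so triangular and block triangular algebras are treated
  together.\<close>

locale incidence_preorder =
  fixes n :: nat and R :: "nat \<Rightarrow> nat \<Rightarrow> bool"
  assumes n3: "3 \<le> n"
    and le_R: "i \<le> j \<Longrightarrow> j < n \<Longrightarrow> R i j"
    and trans_R: "i < n \<Longrightarrow> j < n \<Longrightarrow> k < n \<Longrightarrow> R i j \<Longrightarrow> R j k \<Longrightarrow> R i k"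
begin

lemma obtain_third:
  obtains r where "r < n" "r \<noteq> a" "r \<noteq> b"
  using third_index[OF n3] by blast

lemma refl_R: "i < n \<Longrightarrow> R i i"
  by (rule le_R) auto

lemma total_R: "i < n \<Longrightarrow> j < n \<Longrightarrow> R i j \<or> R j i"
  using le_R by (meson nat_le_linear)

text \<open>\<open>D i j\<close> holds the entries of the value at \<open>E\<^sub>i\<^sub>j\<close> of a Lie derivation.\<close>

definition lie_der :: "(nat \<Rightarrow> nat \<Rightarrow> nat \<Rightarrow> nat \<Rightarrow> 'a::comm_ring_1) \<Rightarrow> bool" where
  "lie_der D \<longleftrightarrow>
     (\<forall>i<n. \<forall>j<n. \<forall>p<n. \<forall>q<n. R i j \<longrightarrow> \<not> R p q \<longrightarrow> D i j p q = 0) \<and>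
     (\<forall>i<n. \<forall>j<n. \<forall>k<n. \<forall>l<n. \<forall>p<n. \<forall>q<n. R i j \<longrightarrow> R k l \<longrightarrow>
        unit_bracket i j (D k l) p q - unit_bracket k l (D i j) p q =
        (if j = k then D i l p q else 0) - (if l = i then D k j p q else 0))"

lemma lie_derD1:
  assumes "lie_der D" "i < n" "j < n" "p < n" "q < n" "R i j" "\<not> R p q"
  shows "D i j p q = 0"
  using assms(1)[unfolded lie_der_def, THEN conjunct1] assms(2-) by simp

lemma lie_derD2:
  assumes "lie_der D" "i < n" "j < n" "k < n" "l < n" "R i j" "R k l" "p < n" "q < n"
  shows "unit_bracket i j (D k l) p q - unit_bracket k l (D i j) p q =
        (if j = k then D i l p q else 0) - (if l = i then D k j p q else 0)"
  using assms(1)[unfolded lie_der_def, THEN conjunct2] assms(2-) by simp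

lemma scalar_by_zero:
  assumes "\<And>j. j < n \<Longrightarrow> j \<noteq> 0 \<Longrightarrow> A 0 0 = A j j"
    and "\<And>p q. p < n \<Longrightarrow> q < n \<Longrightarrow> p \<noteq> q \<Longrightarrow> A p q = 0"
  shows "scalar_entries n A"
  by (rule scalar_entriesI) (use assms in metis)+

text \<open>Brackets with diagonal units confine \<open>D k l\<close> to the positions
  \<open>(k, l)\<close> and \<open>(l, k)\<close> when \<open>k \<noteq> l\<close>. A third index
  removes the second entry. The first is additive along products of units, hence determined by row
  0, where \<open>row0\<close> makes it zero.\<close>

lemma lie_der_diagonal_scalar:
  fixes D :: "nat \<Rightarrow> nat \<Rightarrow> nat \<Rightarrow> nat \<Rightarrow> 'a::comm_ring_1"
  assumes D: "lie_der D"
    and diag: "\<And>j p q. j < n \<Longrightarrow> p < n \<Longrightarrow> q < n \<Longrightarrow> p \<noteq> q \<Longrightarrow> D j j p q = 0"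
    and row0: "\<And>j. 0 < j \<Longrightarrow> j < n \<Longrightarrow> D 0 j 0 j = 0"
    and ij: "i < n" "j < n" "R i j"
  shows "scalar_entries n (D i j)"
proof -
  have n0: "0 < n" using n3 by simp
  have R0: "R 0 k" if "k < n" for k using le_R that by simp
  have weight: "D k l p q = 0"
    if kl: "k < n" "l < n" "R k l" "k \<noteq> l" and pq: "p < n" "q < n"
      and ne: "(p, q) \<noteq> (k, l)" "(p, q) \<noteq> (l, k)" for k l p q
  proof -
    have eq: "unit_bracket r r (D k l) p q - unit_bracket k l (D r r) p q =
        (if r = k then D r l p q else 0) - (if l = r then D k r p q else 0)" if "r < n" for r
      using lie_derD2[OF D that that kl(1,2) refl_R[OF that] kl(3) pq] .
    have z: "unit_bracket k l (D r r) p q = 0" if "r < n" for r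
      using diag[OF that] kl pq ne unfolding unit_bracket_def by auto
    \<comment> \<open>The bracket rule asks the bracket with \<open>E\<^sub>k\<^sub>k\<close> to
      multiply the entry by 1 and the one with \<open>E\<^sub>l\<^sub>l\<close> to multiply it by
      -1. In the first case the former factor is 0, in the second case the latter.\<close>
    consider "p = q \<or> p \<noteq> k \<and> q \<noteq> k" | "p \<noteq> l" "q \<noteq> l"
      using ne kl by auto
    then show ?thesis
    proof cases
      case 1
      then show ?thesis
        using eq[OF kl(1)] z[OF kl(1)] kl(4)
        by (cases "p = q"; cases "q = k") (auto simp: unit_bracket_def)
    next
      case 2
      then show ?thesis
        using eq[OF kl(2)] z[OF kl(2)] kl(4) by (simp add: unit_bracket_def)
    qed
  qed
  \<comment> \<open>The bracket with \<open>E\<^sub>k\<^sub>k\<close> gives only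
    \<open>2 * D k l l k = 0\<close>, which is inconclusive in characteristic 2. The commuting pair
    \<open>E\<^sub>k\<^sub>l\<close>, \<open>E\<^sub>k\<^sub>r\<close> or
    \<open>E\<^sub>k\<^sub>l\<close>, \<open>E\<^sub>r\<^sub>l\<close> isolates the entry
    itself.\<close>
  have flip: "D k l l k = 0" if kl: "k < n" "l < n" "R k l" "k \<noteq> l" for k l
  proof (cases "R l k")
    case False
    then show ?thesis using lie_derD1[OF D kl(1,2) kl(2,1) kl(3)] by simp
  next
    case True
    obtain r where r: "r < n" "r \<noteq> k" "r \<noteq> l" using obtain_third .
    consider "R k r" | "R r k" using total_R[OF kl(1) r(1)] by blast
    then show ?thesis
    proof cases
      case 1
      then show ?thesis
        using lie_derD2[OF D kl(1,2) kl(1) r(1) kl(3) 1 kl(2) r(1)] r kl by (simp add: unit_bracket_def)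
    next
      case 2
      then have "R r l" using trans_R kl r by blast
      then show ?thesis
        using lie_derD2[OF D kl(1,2) r(1) kl(2) kl(3) _ r(1) kl(1)] r kl by (simp add: unit_bracket_def)
    qed
  qed
  \<comment> \<open>For \<open>k \<noteq> 0\<close> use
    \<open>[E\<^sub>0\<^sub>k, E\<^sub>k\<^sub>l] = E\<^sub>0\<^sub>l\<close>: the coefficient is a
    difference of two row 0 coefficients.\<close>
  have coeff_pos: "D k l k l = 0" if kl: "k < n" "l < n" "R k l" "k \<noteq> l" "l \<noteq> 0" for k l
  proof (cases "k = 0")
    case True
    then show ?thesis using row0 kl by simp
  next
    case False
    then show ?thesis
      using lie_derD2[OF D n0 kl(1) kl(1,2) R0[OF kl(1)] kl(3) n0 kl(2)] kl
        row0[of k] row0[of l] by (simp add: unit_bracket_def)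
  qed
  have coeff: "D k l k l = 0" if kl: "k < n" "l < n" "R k l" "k \<noteq> l" for k l
  proof (cases "l = 0")
    case True
    \<comment> \<open>Here
      \<open>[E\<^sub>k\<^sub>0, E\<^sub>0\<^sub>r] = E\<^sub>k\<^sub>r\<close>, whose coefficient
      is already known to vanish.\<close>
    obtain r where r: "r < n" "r \<noteq> k" "r \<noteq> 0" using obtain_third .
    have kr: "R k r" using trans_R[OF kl(1) n0 r(1)] kl True R0[OF r(1)] by simp
    have "R k 0" using kl True by simp
    then show ?thesis
      using lie_derD2[OF D kl(1) n0 n0 r(1) _ R0[OF r(1)] kl(1) r(1)] r kl True
        row0[of r] coeff_pos[OF kl(1) r(1) kr] by (simp add: unit_bracket_def)
  qed (use coeff_pos kl in blast)
  show ?thesis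
  proof (cases "i = j")
    case True
    show ?thesis
    proof (rule scalar_by_zero)
      fix k assume k: "k < n" "k \<noteq> 0"
      \<comment> \<open>At position \<open>(0, k)\<close> the bracket with
        \<open>E\<^sub>0\<^sub>k\<close> shows the difference of these two entries; every other term
        is a multiple of \<open>D 0 k 0 k = 0\<close>.\<close>
      show "D i j 0 0 = D i j k k"
        using lie_derD2[OF D n0 k(1) ij(1,1) R0[OF k(1)] refl_R[OF ij(1)] n0 k(1)] k True
          row0[of k] by (simp add: unit_bracket_def split: if_splits)
    qed (use diag ij True in blast)
  next
    case False
    then have "D i j p q = 0" if "p < n" "q < n" for p q
      using weight[OF ij _ that] flip[OF ij] coeff[OF ij]
      by (cases "(p, q) = (i, j)"; cases "(p, q) = (j, i)") auto
    then show ?thesis by (intro scalar_entriesI) auto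
  qed
qed

text \<open>Jacobi identity: bracketing with a fixed matrix obeys the Lie derivation rule on
  units.\<close>

lemma lie_der_unit_bracket:
  "unit_bracket i j (unit_bracket k l A) p q - unit_bracket k l (unit_bracket i j A) p q =
     (if j = k then unit_bracket i l A p q else 0) - (if l = i then unit_bracket k j A p q else 0)"
  by (simp add: unit_bracket_def)

lemma unit_bracket_diff:
  "unit_bracket i j (\<lambda>p q. A p q - B p q) p q =
   unit_bracket i j A p q - unit_bracket i j B p q"
  by (simp add: unit_bracket_def)

text \<open>Subtracting the inner derivation of a suitable \<open>m\<close> supported on
  \<open>R\<close> leaves a Lie derivation that meets the hypotheses of
  \<open>lie_der_diagonal_scalar\<close>.\<close>

lemma lie_der_inner:
  fixes D :: "nat \<Rightarrow> nat \<Rightarrow> nat \<Rightarrow> nat \<Rightarrow> 'a::comm_ring_1"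
  assumes D: "lie_der D"
  shows "\<exists>m. \<forall>i<n. \<forall>j<n. R i j \<longrightarrow> scalar_entries n (\<lambda>p q. D i j p q - unit_bracket i j m p q)"
proof -
  \<comment> \<open>Off the diagonal, \<open>[E\<^sub>p\<^sub>p, m]\<close> has \<open>(p, q)\<close> entry \<open>m p q\<close>; the diagonal of \<open>m\<close> is chosen to
    match the coefficient of \<open>E\<^sub>0\<^sub>p\<close> in \<open>D 0 p\<close>.\<close>
  define m where "m p q =
    (if \<not> R p q then 0 else if p \<noteq> q then D p p p q else if p = 0 then 0 else D 0 p 0 p)" for p q
  define D' where "D' i j p q = D i j p q - unit_bracket i j m p q" for i j p q
  have D'_eta: "D' i j = (\<lambda>p q. D i j p q - unit_bracket i j m p q)" for i j
    by (intro ext) (simp add: D'_def)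
  have supp: "unit_bracket i j m p q = 0" if "i < n" "j < n" "p < n" "q < n" "R i j" "\<not> R p q" for i j p q
    using that trans_R[of p j q] trans_R[of p i q] by (auto simp: unit_bracket_def m_def)
  have 1: "lie_der D'"
    unfolding lie_der_def
  proof (intro conjI allI impI)
    fix i j p q assume "i < n" "j < n" "p < n" "q < n" "R i j" "\<not> R p q"
    then show "D' i j p q = 0" using supp lie_derD1[OF D] by (simp add: D'_def)
  next
    fix i j k l p q
    assume a: "i < n" "j < n" "k < n" "l < n" "p < n" "q < n" "R i j" "R k l"
    show "unit_bracket i j (D' k l) p q - unit_bracket k l (D' i j) p q =
        (if j = k then D' i l p q else 0) - (if l = i then D' k j p q else 0)"
    proof -
      have "unit_bracket i j (D' k l) p q - unit_bracket k l (D' i j) p q =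
          (unit_bracket i j (D k l) p q - unit_bracket k l (D i j) p q) -
          (unit_bracket i j (unit_bracket k l m) p q - unit_bracket k l (unit_bracket i j m) p q)"
        unfolding D'_eta unit_bracket_diff by simp
      then show ?thesis
        unfolding lie_derD2[OF D a(1-4,7,8,5,6)] lie_der_unit_bracket by (simp add: D'_def)
    qed
  qed
  \<comment> \<open>Since diagonal units commute, \<open>D j j\<close> vanishes off the diagonal
    outside row and column \<open>j\<close>, and \<open>D j j p j = - D p p p j\<close>. So
    \<open>m\<close>, whose row \<open>p\<close> comes from \<open>D p p\<close>, also cancels
    column \<open>j\<close> of \<open>D j j\<close>.\<close>
  have 2: "D' j j p q = 0" if jpq: "j < n" "p < n" "q < n" "p \<noteq> q" for j p q
  proof -
    have Dz: "D j j p q = 0" if "\<not> R p q"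
      using lie_derD1[OF D] jpq refl_R that by blast
    have cross: "D j j p q = 0" if "p \<noteq> j" "q \<noteq> j"
      using lie_derD2[OF D jpq(2,2) jpq(1,1) _ _ jpq(2,3)] jpq refl_R that by (simp add: unit_bracket_def)
    have col: "D j j p q = - D p p p q" if "q = j"
      using lie_derD2[OF D jpq(2,2) jpq(1,1) _ _ jpq(2,3)] jpq refl_R that
      by (simp add: unit_bracket_def add_eq_0_iff2)
    show ?thesis using jpq Dz cross col by (auto simp: D'_def unit_bracket_def m_def)
  qed
  have 3: "D' 0 j 0 j = 0" if "0 < j" "j < n" for j
    using that le_R[of 0 j] le_R[of j j] by (auto simp: D'_def unit_bracket_def m_def)
  have "scalar_entries n (D' i j)" if "i < n" "j < n" "R i j" for i j
    by (rule lie_der_diagonal_scalar[OF 1 2 3 that])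
  then show ?thesis unfolding D'_eta by (intro exI[of _ m]) simp
qed

end

subsection \<open>The identity \<open>[x, m y] \<equiv> [y, m' x]\<close>\<close>

definition unit_entry :: "nat \<Rightarrow> nat \<Rightarrow> nat \<Rightarrow> nat \<Rightarrow> 'a::comm_ring_1" where
  "unit_entry i j p q = (if p = i \<and> q = j then 1 else 0)"

context incidence_preorder
begin

text \<open>\<open>M k l\<close> and \<open>M' i j\<close> stand for \<open>m E\<^sub>k\<^sub>l\<close> and \<open>m' E\<^sub>i\<^sub>j\<close>.\<close>

definition exchange ::
  "(nat \<Rightarrow> nat \<Rightarrow> nat \<Rightarrow> nat \<Rightarrow> 'a::comm_ring_1) \<Rightarrow> (nat \<Rightarrow> nat \<Rightarrow> nat \<Rightarrow> nat \<Rightarrow> 'a) \<Rightarrow> bool" where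
  "exchange M M' \<longleftrightarrow>
     (\<forall>i<n. \<forall>j<n. \<forall>k<n. \<forall>l<n. R i j \<longrightarrow> R k l \<longrightarrow>
        scalar_entries n (\<lambda>p q. unit_bracket i j (M k l) p q - unit_bracket k l (M' i j) p q))"

lemma exchange_off:
  assumes "exchange M M'" "i < n" "j < n" "k < n" "l < n" "R i j" "R k l"
    "p < n" "q < n" "p \<noteq> q"
  shows "unit_bracket i j (M k l) p q = unit_bracket k l (M' i j) p q"
  using assms(1)[unfolded exchange_def scalar_entries_def] assms(2-) by simp

lemma exchange_diag:
  assumes "exchange M M'" "i < n" "j < n" "k < n" "l < n" "R i j" "R k l" "p < n" "q < n"
  shows "unit_bracket i j (M k l) p p - unit_bracket k l (M' i j) p p =
    unit_bracket i j (M k l) q q - unit_bracket k l (M' i j) q q"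
proof -
  have "scalar_entries n (\<lambda>p q. unit_bracket i j (M k l) p q - unit_bracket k l (M' i j) p q)"
    using assms(1)[unfolded exchange_def] assms(2-) by simp
  then show ?thesis using assms(8,9) unfolding scalar_entries_def by blast
qed

text \<open>This transfers facts about \<open>M\<close> to \<open>M'\<close>.\<close>

lemma exchange_sym:
  assumes "exchange M M'"
  shows "exchange M' M"
  unfolding exchange_def
proof (intro allI impI scalar_entriesI)
  fix i j k l p q assume a: "i < n" "j < n" "k < n" "l < n" "R i j" "R k l" "p < n" "q < n"
  show "unit_bracket i j (M' k l) p p - unit_bracket k l (M i j) p p =
      unit_bracket i j (M' k l) q q - unit_bracket k l (M i j) q q"
    using exchange_diag[OF assms a(3,4,1,2,6,5,7,8)] by (simp add: algebra_simps)
  show "unit_bracket i j (M' k l) p q - unit_bracket k l (M i j) p q = 0" if "p \<noteq> q"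
    using exchange_off[OF assms a(3,4,1,2,6,5,7,8) that] by simp
qed

lemma exchange_diff:
  assumes "exchange M M'" "exchange L L'"
  shows "exchange (\<lambda>k l p q. M k l p q - L k l p q) (\<lambda>k l p q. M' k l p q - L' k l p q)"
  unfolding exchange_def
proof (intro allI impI scalar_entriesI)
  fix i j k l p q assume a: "i < n" "j < n" "k < n" "l < n" "R i j" "R k l" "p < n" "q < n"
  have "unit_bracket i j (\<lambda>p q. M k l p q - L k l p q) r r -
      unit_bracket k l (\<lambda>p q. M' i j p q - L' i j p q) r r =
      (unit_bracket i j (M k l) r r - unit_bracket k l (M' i j) r r) -
      (unit_bracket i j (L k l) r r - unit_bracket k l (L' i j) r r)" for r
    unfolding unit_bracket_diff by simp
  then show "unit_bracket i j (\<lambda>p q. M k l p q - L k l p q) p p -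
      unit_bracket k l (\<lambda>p q. M' i j p q - L' i j p q) p p =
      unit_bracket i j (\<lambda>p q. M k l p q - L k l p q) q q -
      unit_bracket k l (\<lambda>p q. M' i j p q - L' i j p q) q q"
    by (simp only: exchange_diag[OF assms(1) a] exchange_diag[OF assms(2) a])
  show "unit_bracket i j (\<lambda>p q. M k l p q - L k l p q) p q -
      unit_bracket k l (\<lambda>p q. M' i j p q - L' i j p q) p q = 0"
    if "p \<noteq> q"
    using exchange_off[OF assms(1) a that] exchange_off[OF assms(2) a that]
    unfolding unit_bracket_diff by simp
qed

text \<open>First model solution: \<open>[x, c y] = [y, - c x]\<close> holds exactly.\<close>

lemma exchange_scaled_unit:
  "exchange (\<lambda>k l p q. c * unit_entry k l p q) (\<lambda>k l p q. - c * unit_entry k l p q)"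
proof -
  have "unit_bracket i j (\<lambda>p q. c * unit_entry k l p q) p q =
      unit_bracket k l (\<lambda>p q. - c * unit_entry i j p q) p q" for i j k l p q
    by (auto simp: unit_bracket_def unit_entry_def)
  then show ?thesis unfolding exchange_def by (auto intro: scalar_entriesI)
qed

text \<open>The first and the last diagonal block have size 1.\<close>

definition corner_isolated :: bool where
  "corner_isolated \<longleftrightarrow> (\<forall>k<n. k \<noteq> 0 \<longrightarrow> \<not> R k 0) \<and> (\<forall>k<n. k \<noteq> n - 1 \<longrightarrow> \<not> R (n - 1) k)"

text \<open>For an isolated corner, \<open>E\<^sub>0\<^sub>N\<close> with \<open>N = n - 1\<close>
  is a common eigenvector of all brackets with units of the algebra. Only
  \<open>E\<^sub>0\<^sub>0\<close> and \<open>E\<^sub>N\<^sub>N\<close> act with nonzero weight,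
  namely 1 and -1.\<close>

lemma unit_bracket_corner:
  assumes "corner_isolated" "k < n" "l < n" "R k l"
  shows "unit_bracket k l (\<lambda>p q. c * unit_entry 0 (n - 1) p q) p q =
    ((if k = 0 \<and> l = 0 then 1 else 0) - (if k = n - 1 \<and> l = n - 1 then 1 else 0)) *
    (c * unit_entry 0 (n - 1) p q)"
  using assms unfolding corner_isolated_def by (auto simp: unit_bracket_def unit_entry_def)

lemma unit_bracket_scale: "unit_bracket i j (\<lambda>p q. c * A p q) p q = c * unit_bracket i j A p q"
  by (simp add: unit_bracket_def algebra_simps)

text \<open>Second model solution: both iterated brackets multiply the same eigenvector by two
  weights, and the weights commute.\<close>

lemma exchange_corner:
  assumes "c = 0 \<or> corner_isolated"
  shows "exchange (\<lambda>k l. unit_bracket k l (\<lambda>p q. c * unit_entry 0 (n - 1) p q))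
                  (\<lambda>k l. unit_bracket k l (\<lambda>p q. c * unit_entry 0 (n - 1) p q))"
proof (cases "c = 0")
  case True
  then show ?thesis unfolding exchange_def by (auto intro: scalar_entriesI simp: unit_bracket_def)
next
  case False
  then have ci: corner_isolated using assms by simp
  show ?thesis
    unfolding exchange_def
  proof (intro allI impI scalar_entriesI)
    fix i j k l p q assume a: "i < n" "j < n" "k < n" "l < n" "R i j" "R k l"
    have "unit_bracket i j (unit_bracket k l (\<lambda>p q. c * unit_entry 0 (n - 1) p q)) p q =
          unit_bracket k l (unit_bracket i j (\<lambda>p q. c * unit_entry 0 (n - 1) p q)) p q" for p q
      unfolding unit_bracket_corner[OF ci a(1,2,5), abs_def] unit_bracket_corner[OF ci a(3,4,6), abs_def]
        unit_bracket_scale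
        unit_bracket_corner[OF ci a(1,2,5)] unit_bracket_corner[OF ci a(3,4,6)] by (simp add: algebra_simps)
    then show "unit_bracket i j (unit_bracket k l (\<lambda>p q. c * unit_entry 0 (n - 1) p q)) p q -
          unit_bracket k l (unit_bracket i j (\<lambda>p q. c * unit_entry 0 (n - 1) p q)) p q = 0"
      and "unit_bracket i j (unit_bracket k l (\<lambda>p q. c * unit_entry 0 (n - 1) p q)) p p -
          unit_bracket k l (unit_bracket i j (\<lambda>p q. c * unit_entry 0 (n - 1) p q)) p p =
          unit_bracket i j (unit_bracket k l (\<lambda>p q. c * unit_entry 0 (n - 1) p q)) q q -
          unit_bracket k l (unit_bracket i j (\<lambda>p q. c * unit_entry 0 (n - 1) p q)) q q"
      by simp_all
  qed
qed

section \<open>Values of a solution at the diagonal units\<close>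

lemma exchange_diagonal_offdiag:
  assumes M: "exchange M M'" and j: "j < n" and pq: "p < n" "q < n" "p \<noteq> q" "p \<noteq> j" "q \<noteq> j"
  shows "M j j p q = 0"
  using exchange_off[OF M pq(1,1) j j refl_R[OF pq(1)] refl_R[OF j] pq(1-3)] pq
  by (simp add: unit_bracket_def)

text \<open>The bracket with \<open>E\<^sub>j\<^sub>j\<close> vanishes at \<open>(p, q)\<close>,
  where \<open>[E\<^sub>p\<^sub>q, M j j]\<close> shows the difference of the two diagonal
  entries.\<close>

lemma exchange_diagonal_diag:
  assumes M: "exchange M M'" and j: "j < n" and pq: "p < n" "q < n" "p \<noteq> j" "q \<noteq> j"
  shows "M j j p p = M j j q q"
proof -
  have "M j j p p = M j j q q" if pq: "p < n" "q < n" "p \<noteq> j" "q \<noteq> j" "p < q" for p q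
    using exchange_off[OF M pq(1,2) j j le_R[OF _ pq(2)] refl_R[OF j] pq(1,2)] pq
    by (simp add: unit_bracket_def)
  then show ?thesis using pq by (metis nat_neq_iff)
qed

text \<open>Taking \<open>x = E\<^sub>k\<^sub>j\<close> moves row \<open>j\<close> of
  \<open>M j j\<close> to row \<open>k\<close>, where a bracket with
  \<open>E\<^sub>j\<^sub>j\<close> vanishes outside column \<open>j\<close>.\<close>

lemma exchange_diagonal_row:
  assumes M: "exchange M M'" and k: "k < n" "k \<noteq> j" "R k j" and j: "j < n"
    and l: "l < n" "l \<noteq> j"
  shows "M j j j l = 0"
proof (cases "l = k")
  case True
  \<comment> \<open>The congruence fixes the diagonal entry \<open>(k, k)\<close> only up to a
    scalar, so it is compared with the entry \<open>(r, r)\<close>, where both brackets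
    vanish.\<close>
  obtain r where r: "r < n" "r \<noteq> j" "r \<noteq> k" using obtain_third .
  show ?thesis
    using exchange_diag[OF M k(1) j j j k(3) refl_R[OF j] k(1) r(1)] r k True by (simp add: unit_bracket_def)
next
  case False
  then show ?thesis
    using exchange_off[OF M k(1) j j j k(3) refl_R[OF j] k(1) l(1)] k l by (simp add: unit_bracket_def)
qed

text \<open>The transposed argument, with \<open>x = E\<^sub>j\<^sub>k\<close>.\<close>

lemma exchange_diagonal_col:
  assumes M: "exchange M M'" and k: "k < n" "k \<noteq> j" "R j k" and j: "j < n"
    and l: "l < n" "l \<noteq> j"
  shows "M j j l j = 0"
proof (cases "l = k")
  case True
  obtain r where r: "r < n" "r \<noteq> j" "r \<noteq> k" using obtain_third .
  show ?thesis
    using exchange_diag[OF M j k(1) j j k(3) refl_R[OF j] k(1) r(1)] r k True by (simp add: unit_bracket_def)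
next
  case False
  then show ?thesis
    using exchange_off[OF M j k(1) j j k(3) refl_R[OF j] l(1) k(1)] k l by (simp add: unit_bracket_def)
qed

text \<open>Both differences equal \<open>- M' k l k l\<close>, by taking
  \<open>x = E\<^sub>k\<^sub>l\<close> with \<open>y = E\<^sub>k\<^sub>k\<close> and then with
  \<open>y = E\<^sub>l\<^sub>l\<close>.\<close>

lemma exchange_diagonal_weight:
  assumes M: "exchange M M'" and kl: "k < n" "l < n" "k < l"
  shows "M k k k k - M k k l l = M l l l l - M l l k k"
proof -
  have "R k l" using kl le_R by simp
  then show ?thesis
    using exchange_off[OF M kl(1,2) kl(1,1) _ refl_R[OF kl(1)] kl(1,2)]
      exchange_off[OF M kl(1,2) kl(2,2) _ refl_R[OF kl(2)] kl(1,2)] kl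
    by (simp add: unit_bracket_def algebra_simps)
qed

section \<open>Solutions that are scalar at the diagonal units\<close>

lemma unit_bracket_scalar:
  assumes A: "scalar_entries n A" and ij: "i < n" "j < n" and pq: "p < n" "q < n"
  shows "unit_bracket i j A p q = 0"
proof -
  have A': "A r s = (if r = s then A p p else 0)" if "r < n" "s < n" for r s
    using scalar_entries_offD[OF A that] scalar_entries_diagD[OF A that(1) pq(1)] by (cases "r = s") simp_all
  show ?thesis unfolding unit_bracket_def A'[OF ij(2) pq(2)] A'[OF pq(1) ij(1)] by auto
qed

text \<open>Brackets with the scalar matrix \<open>M p p\<close> vanish, so
  \<open>[E\<^sub>p\<^sub>p, M' i j]\<close> is scalar, and its \<open>(p, q)\<close> entry is the
  one in question.\<close>

lemma exchange_normalized_off: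
  assumes M: "exchange M M'" and diag: "\<And>j. j < n \<Longrightarrow> scalar_entries n (M j j)"
    and ij: "i < n" "j < n" "R i j" and pq: "p < n" "q < n" "p \<noteq> q"
  shows "M' i j p q = 0"
  using exchange_off[OF M ij(1,2) pq(1,1) ij(3) refl_R[OF pq(1)] pq]
    unit_bracket_scalar[OF diag[OF pq(1)] ij(1,2) pq(1,2)] pq
  by (simp add: unit_bracket_def)

text \<open>All \<open>M' i j\<close> are now diagonal. Hence \<open>M k l\<close> has at most the
  off-diagonal entry \<open>(k, l)\<close>, and brackets with \<open>E\<^sub>r\<^sub>s\<close>
  equalise its diagonal. A third index removes the remaining entry.\<close>

lemma exchange_normalized:
  assumes M: "exchange M M'" and diag: "\<And>j. j < n \<Longrightarrow> scalar_entries n (M j j)"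
    and kl: "k < n" "l < n" "R k l"
  shows "scalar_entries n (M k l)"
proof (cases "k = l")
  case True
  then show ?thesis using diag kl by simp
next
  case ne: False
  have M'_off: "M' i j p q = 0" if "i < n" "j < n" "R i j" "p < n" "q < n" "p \<noteq> q" for i j p q
    using exchange_normalized_off[OF M diag that] .
  have off: "M i j p q = 0"
    if ij: "i < n" "j < n" "R i j" and pq: "p < n" "q < n" "p \<noteq> q" "(p, q) \<noteq> (i, j)" for i j p q
    using exchange_off[OF M pq(1,1) ij(1,2) refl_R[OF pq(1)] ij(3) pq(1-3)]
      M'_off[OF pq(1,1) refl_R[OF pq(1)]] ij pq by (auto simp: unit_bracket_def split: if_splits)
  \<comment> \<open>If \<open>R r i\<close>, then \<open>x = E\<^sub>r\<^sub>i\<close> moves the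
    entry to \<open>(r, j)\<close>, where the other side shows an off-diagonal entry of
    \<open>M' r i\<close>. If \<open>R j r\<close>, then \<open>x = E\<^sub>j\<^sub>r\<close> does
    the same at \<open>(i, r)\<close>.\<close>
  have upper: "M i j i j = 0"
    if ij: "i < n" "j < n" "R i j" "i \<noteq> j" and r: "r < n" "r \<noteq> i" "r \<noteq> j" "R r i \<or> R j r" for i j r
    using r(4)
  proof
    assume ri: "R r i"
    show ?thesis
      using exchange_off[OF M r(1) ij(1) ij(1,2) ri ij(3) r(1) ij(2)]
        M'_off[OF r(1) ij(1) ri r(1) ij(1)] ij r by (simp add: unit_bracket_def)
  next
    assume jr: "R j r"
    show ?thesis
      using exchange_off[OF M ij(2) r(1) ij(1,2) jr ij(3) ij(1) r(1)]
        M'_off[OF ij(2) r(1) jr ij(2) r(1)] ij r by (simp add: unit_bracket_def)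
  qed
  have same: "M k l r r = M k l s s" if rs: "r < s" "s < n" "(r, s) \<noteq> (k, l)" for r s
  proof -
    have r: "r < n" using rs by simp
    have Rrs: "R r s" using rs le_R by simp
    show ?thesis
      using exchange_off[OF M r rs(2) kl(1,2) Rrs kl(3) r rs(2)]
        M'_off[OF r rs(2) Rrs] rs r kl ne by (auto simp: unit_bracket_def split: if_splits)
  qed
  \<comment> \<open>As \<open>same\<close> excludes the pair \<open>(k, l)\<close>, every diagonal
    entry is compared with the one at a third index.\<close>
  obtain r where r: "r < n" "r \<noteq> k" "r \<noteq> l" using obtain_third .
  have same': "M k l r r = M k l s s" if "s < n" for s
  proof (cases r s rule: linorder_cases)
    case less
    then show ?thesis using same[OF less that] r by simp
  next
    case greater
    then show ?thesis using same[OF greater r(1)] r by simp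
  qed simp
  have "M k l k l = 0"
  proof (cases "R r k \<or> R l r")
    case True
    then show ?thesis using upper kl ne r by blast
  next
    \<comment> \<open>Now \<open>r\<close> lies between \<open>k\<close> and \<open>l\<close>. By
      \<open>x = E\<^sub>k\<^sub>k\<close>, the entry \<open>M k l k l\<close> is the difference of
      the diagonal entries of \<open>M' k k\<close> at \<open>l\<close> and \<open>k\<close>; the
      corresponding differences from \<open>k\<close> to \<open>r\<close> and from \<open>r\<close>
      to \<open>l\<close> vanish.\<close>
    case False
    then have kr: "R k r" and rl: "R r l" using total_R kl r by blast+
    have "M k r k r = 0" by (rule upper[OF kl(1) r(1) kr _ kl(2)]) (use r ne rl in auto)
    moreover have "M r l r l = 0" by (rule upper[OF r(1) kl(2) rl _ kl(1)]) (use r ne kr in auto)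
    ultimately show ?thesis
      using exchange_off[OF M kl(1,1) kl(1,2) refl_R[OF kl(1)] kl(3) kl(1,2)]
        exchange_off[OF M kl(1,1) kl(1) r(1) refl_R[OF kl(1)] kr kl(1) r(1)]
        exchange_off[OF M kl(1,1) r(1) kl(2) refl_R[OF kl(1)] rl r(1) kl(2)] ne r
      by (simp add: unit_bracket_def)
  qed
  then have "M k l p q = 0" if "p < n" "q < n" "p \<noteq> q" for p q
    using off[OF kl that] by (cases "(p, q) = (k, l)") auto
  moreover have "M k l p p = M k l q q" if "p < n" "q < n" for p q
    using same'[OF that(1)] same'[OF that(2)] by simp
  ultimately show ?thesis by (rule scalar_entriesI)
qed

text \<open>The constants are read off from \<open>M 0 0\<close>. Subtracting both model solutions
  leaves \<open>L\<close>, which is scalar at the diagonal units, so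
  \<open>exchange_normalized\<close> applies.\<close>

lemma exchange_solution:
  fixes M :: "nat \<Rightarrow> nat \<Rightarrow> nat \<Rightarrow> nat \<Rightarrow> 'a::comm_ring_1"
  assumes M: "exchange M M'"
  shows "\<exists>c a. (a = 0 \<or> corner_isolated) \<and>
    (\<forall>k<n. \<forall>l<n. R k l \<longrightarrow>
      scalar_entries n (\<lambda>p q. M k l p q - c * unit_entry k l p q -
        unit_bracket k l (\<lambda>p q. a * unit_entry 0 (n - 1) p q) p q))"
proof -
  note M' = exchange_sym[OF M]
  define N where "N = n - 1"
  have N: "N < n" "N \<noteq> 0" "0 < n" using n3 by (auto simp: N_def)
  have R0: "R 0 k" if "k < n" for k using le_R that by simp
  have RN: "R k N" if "k < n" for k using le_R that N by (simp add: N_def)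
  \<comment> \<open>The matrix \<open>c E\<^sub>0\<^sub>0 +
    [E\<^sub>0\<^sub>0, a E\<^sub>0\<^sub>N]\<close> has entry \<open>a\<close> at
    \<open>(0, N)\<close>, and its first and last diagonal entries differ by
    \<open>c\<close>.\<close>
  define a where "a = M 0 0 0 N"
  define c where "c = M 0 0 0 0 - M 0 0 N N"
  \<comment> \<open>Index 0 precedes and \<open>N\<close> follows every index, so only row 0 of
    \<open>M 0 0\<close> and column \<open>N\<close> of \<open>M N N\<close> escape these two
    facts.\<close>
  have row: "L j j j l = 0" if "exchange L L'" "0 < j" "j < n" "l < n" "l \<noteq> j" for L L' j l
    using exchange_diagonal_row[OF that(1) N(3) _ R0] that by simp
  have col: "L j j l j = 0" if "exchange L L'" "j \<noteq> N" "j < n" "l < n" "l \<noteq> j" for L L' j l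
    using exchange_diagonal_col[OF that(1) N(1) _ RN] that by simp
  \<comment> \<open>Taking \<open>x = E\<^sub>l\<^sub>l\<close> carries this entry, up to sign, into
    column \<open>l\<close> of \<open>M' l l\<close>, which vanishes because
    \<open>l \<noteq> N\<close>.\<close>
  have M0: "M 0 0 0 l = 0" if "0 < l" "l < n" "l \<noteq> N" for l
    using exchange_off[OF M that(2,2) N(3,3) refl_R[OF that(2)] R0[OF N(3)] N(3) that(2)]
      col[OF M' that(3,2) N(3)] that by (simp add: unit_bracket_def)
  have MN: "M N N l N = 0" if "0 < l" "l < n" "l \<noteq> N" for l
    using exchange_off[OF M that(2,2) N(1,1) refl_R[OF that(2)] RN[OF N(1)] that(2) N(1)]
      row[OF M' that(1,2) N(1)] that by (simp add: unit_bracket_def)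
  \<comment> \<open>Both corner entries equal \<open>M' 0 0 0 N\<close> up to sign.\<close>
  have a': "M N N 0 N = - a"
    using exchange_off[OF M N(3,3) N(1,1) R0[OF N(3)] RN[OF N(1)] N(3) N(1)]
      exchange_off[OF M N(3,3) N(3,3) R0[OF N(3)] R0[OF N(3)] N(3) N(1)] N
    by (simp add: unit_bracket_def a_def)
  \<comment> \<open>An index \<open>k \<noteq> 0\<close> with \<open>R k 0\<close> makes the row
    lemma available at 0, and \<open>k \<noteq> N\<close> with \<open>R N k\<close> the column lemma
    at \<open>N\<close>. Either forces \<open>a = 0\<close>.\<close>
  have corner: "a = 0 \<or> corner_isolated"
  proof (rule ccontr)
    assume "\<not> ?thesis"
    then have a0: "a \<noteq> 0" and "\<not> corner_isolated" by auto
    then consider k where "k < n" "k \<noteq> 0" "R k 0" | k where "k < n" "k \<noteq> N" "R N k"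
      unfolding corner_isolated_def N_def by blast
    then show False
    proof cases
      case 1
      then show ?thesis using exchange_diagonal_row[OF M 1 N(3) N(1)] N a0 by (simp add: a_def)
    next
      case 2
      then show ?thesis using exchange_diagonal_col[OF M 2 N(1) N(3)] N a0 a' by simp
    qed
  qed
  \<comment> \<open>Independence of \<open>p\<close> is \<open>exchange_diagonal_diag\<close>;
    \<open>exchange_diagonal_weight\<close> links index \<open>j\<close> to index 0.\<close>
  have weight: "M j j j j - M j j p p = c" if jp: "j < n" "p < n" "p \<noteq> j" for j p
  proof (cases "j = 0")
    case True
    then show ?thesis using exchange_diagonal_diag[OF M N(3) jp(2) N(1)] jp N by (simp add: c_def)
  next
    case False
    then show ?thesis
      using exchange_diagonal_weight[OF M N(3) jp(1)] exchange_diagonal_diag[OF M jp(1) jp(2) N(3)]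
        exchange_diagonal_diag[OF M N(3) jp(1) N(1)] jp N by (simp add: c_def)
  qed
  define L where "L k l p q = M k l p q - c * unit_entry k l p q -
        unit_bracket k l (\<lambda>p q. a * unit_entry 0 (n - 1) p q) p q"
    for k l p q
  have L_eq: "L k l p q = M k l p q - c * unit_entry k l p q - unit_bracket k l (\<lambda>p q. a * unit_entry 0 N p q) p q"
    for k l p q
    by (simp add: L_def N_def)
  have "scalar_entries n (L j j)" if j: "j < n" for j
  proof (rule scalar_entriesI)
    fix p q assume pq: "p < n" "q < n"
    have "L j j p p = M j j j j - c" if "p < n" for p
      using weight[OF j that] N by (cases "p = j") (auto simp: L_eq unit_entry_def unit_bracket_def algebra_simps)
    then show "L j j p p = L j j q q" using pq by simp
    assume "p \<noteq> q"
    then show "L j j p q = 0"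
      using exchange_diagonal_offdiag[OF M j pq] row[OF M _ j pq(2)] col[OF M _ j pq(1)]
        M0[of q] MN[of p] a' pq N j a_def[symmetric]
      by (auto simp: L_eq unit_entry_def unit_bracket_def)
  qed
  moreover have "exchange L (\<lambda>k l p q. M' k l p q - - c * unit_entry k l p q -
      unit_bracket k l (\<lambda>p q. a * unit_entry 0 (n - 1) p q) p q)"
    unfolding L_def by (intro exchange_diff M exchange_scaled_unit exchange_corner corner)
  ultimately have "scalar_entries n (L k l)" if "k < n" "l < n" "R k l" for k l
    using exchange_normalized[of L] that by simp
  then show ?thesis
    using corner unfolding L_def[abs_def] by (intro exI[of _ c] exI[of _ a]) simp
qed

end

subsection \<open>Matrix algebras given by a zero pattern\<close>

definition unit_mat :: "nat \<Rightarrow> nat \<Rightarrow> nat \<Rightarrow> 'a::comm_ring_1 mat" where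
  "unit_mat n i j = mat n n (\<lambda>(p, q). unit_entry i j p q)"

lemma unit_mat_carrier [simp]: "unit_mat n i j \<in> carrier_mat n n"
  by (simp add: unit_mat_def)

lemma unit_mat_dim [simp]: "dim_row (unit_mat n i j) = n" "dim_col (unit_mat n i j) = n"
  by (simp_all add: unit_mat_def)

lemma unit_mat_index [simp]: "p < n \<Longrightarrow> q < n \<Longrightarrow> unit_mat n i j $$ (p, q) = unit_entry i j p q"
  by (simp add: unit_mat_def)

lemma lie_bracket_carrier [simp]:
  "x \<in> carrier_mat n n \<Longrightarrow> y \<in> carrier_mat n n \<Longrightarrow> lie_bracket x y \<in> carrier_mat n n"
  by (auto simp: lie_bracket_def intro!: minus_carrier_mat mult_carrier_mat)

lemma lie_bracket_dim [simp]:
  "dim_row (lie_bracket x y) = dim_row y" "dim_col (lie_bracket x y) = dim_col x"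
  by (simp_all add: lie_bracket_def)

lemma unit_mat_mult_index:
  assumes "A \<in> carrier_mat n n" "i < n" "j < n" "p < n" "q < n"
  shows "(unit_mat n i j * A) $$ (p, q) = (if p = i then A $$ (j, q) else 0)"
    and "(A * unit_mat n i j) $$ (p, q) = (if q = j then A $$ (p, i) else 0)"
proof -
  have "(unit_mat n i j * A) $$ (p, q) = (\<Sum>r\<in>{0..<n}. unit_entry i j p r * A $$ (r, q))"
    using assms by (simp add: scalar_prod_def)
  also have "\<dots> = (\<Sum>r\<in>{0..<n}. if r = j then (if p = i then A $$ (j, q) else 0) else 0)"
    by (rule sum.cong) (auto simp: unit_entry_def)
  finally show "(unit_mat n i j * A) $$ (p, q) = (if p = i then A $$ (j, q) else 0)"
    using assms by simp
  have "(A * unit_mat n i j) $$ (p, q) = (\<Sum>r\<in>{0..<n}. A $$ (p, r) * unit_entry i j r q)"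
    using assms by (simp add: scalar_prod_def)
  also have "\<dots> = (\<Sum>r\<in>{0..<n}. if r = i then (if q = j then A $$ (p, i) else 0) else 0)"
    by (rule sum.cong) (auto simp: unit_entry_def)
  finally show "(A * unit_mat n i j) $$ (p, q) = (if q = j then A $$ (p, i) else 0)"
    using assms by simp
qed

lemma lie_bracket_index:
  assumes "x \<in> carrier_mat n n" "y \<in> carrier_mat n n" "p < n" "q < n"
  shows "lie_bracket x y $$ (p, q) = (x * y) $$ (p, q) - (y * x) $$ (p, q)"
  using assms by (simp add: lie_bracket_def del: index_mult_mat(1))

lemma lie_bracket_unit_mat_index:
  assumes "A \<in> carrier_mat n n" "i < n" "j < n" "p < n" "q < n"
  shows "lie_bracket (unit_mat n i j) A $$ (p, q) = unit_bracket i j (\<lambda>p q. A $$ (p, q)) p q"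
    and "lie_bracket A (unit_mat n i j) $$ (p, q) = - unit_bracket i j (\<lambda>p q. A $$ (p, q)) p q"
  unfolding lie_bracket_index[OF unit_mat_carrier assms(1,4,5)]
    lie_bracket_index[OF assms(1) unit_mat_carrier assms(4,5)]
    unit_mat_mult_index[OF assms] unit_bracket_def by simp_all

lemma lie_bracket_unit_mat_unit_mat:
  assumes "i < n" "j < n" "k < n" "l < n"
  shows "lie_bracket (unit_mat n i j) (unit_mat n k l) =
    (if j = k then unit_mat n i l else 0\<^sub>m n n) - (if l = i then unit_mat n k j else 0\<^sub>m n n)"
proof (rule eq_matI)
  fix p q
  assume "p < dim_row ((if j = k then unit_mat n i l else 0\<^sub>m n n) -
      (if l = i then unit_mat n k j else 0\<^sub>m n n))"
    and "q < dim_col ((if j = k then unit_mat n i l else 0\<^sub>m n n) -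
      (if l = i then unit_mat n k j else 0\<^sub>m n n))"
  then have "p < n" "q < n" by (auto simp: unit_mat_def split: if_splits)
  then show "lie_bracket (unit_mat n i j) (unit_mat n k l) $$ (p, q) =
      ((if j = k then unit_mat n i l else 0\<^sub>m n n) - (if l = i then unit_mat n k j else 0\<^sub>m n n)) $$ (p, q)"
    using assms by (simp add: lie_bracket_unit_mat_index) (auto simp: unit_bracket_def unit_entry_def unit_mat_def)
qed (auto simp: lie_bracket_def unit_mat_def)

lemma lie_bracket_add:
  assumes "x \<in> carrier_mat n n" "y \<in> carrier_mat n n" "b \<in> carrier_mat n n"
  shows "lie_bracket (x + y) b = lie_bracket x b + lie_bracket y b"
    and "lie_bracket b (x + y) = lie_bracket b x + lie_bracket b y"
proof -
  have "lie_bracket (x + y) b $$ (p, q) = (lie_bracket x b + lie_bracket y b) $$ (p, q)"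
    and "lie_bracket b (x + y) $$ (p, q) = (lie_bracket b x + lie_bracket b y) $$ (p, q)"
    if "p < n" "q < n" for p q
    using assms that
    by (simp_all add: lie_bracket_def add_mult_distrib_mat[of _ n n] mult_add_distrib_mat[of _ n n]
        del: index_mult_mat(1))
  then show "lie_bracket (x + y) b = lie_bracket x b + lie_bracket y b"
    and "lie_bracket b (x + y) = lie_bracket b x + lie_bracket b y"
    using assms by (auto simp: lie_bracket_def intro!: eq_matI simp del: index_mult_mat(1))
qed

lemma lie_bracket_smult:
  assumes "x \<in> carrier_mat n n" "b \<in> carrier_mat n n"
  shows "lie_bracket (c \<cdot>\<^sub>m x) b = c \<cdot>\<^sub>m lie_bracket x b"
    and "lie_bracket b (c \<cdot>\<^sub>m x) = c \<cdot>\<^sub>m lie_bracket b x"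
  using assms
  by (auto simp: lie_bracket_def mult_smult_assoc_mat[of _ n n] mult_smult_distrib[of _ n n]
      algebra_simps intro!: eq_matI simp del: index_mult_mat(1))

lemma lie_bracket_zero:
  "b \<in> carrier_mat n n \<Longrightarrow> lie_bracket b (0\<^sub>m n n) = 0\<^sub>m n n"
  by (simp add: lie_bracket_def)

context incidence_preorder
begin

text \<open>The structural matrix algebra, or incidence algebra, of the preorder
  \<open>R\<close>.\<close>

definition pattern_algebra :: "'a::comm_ring_1 mat set" where
  "pattern_algebra = {A \<in> carrier_mat n n. \<forall>i<n. \<forall>j<n. \<not> R i j \<longrightarrow> A $$ (i, j) = 0}"

definition scalar_mats :: "'a::comm_ring_1 mat set" where
  "scalar_mats = {A \<in> carrier_mat n n. scalar_entries n (\<lambda>p q. A $$ (p, q))}"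

lemma pattern_carrier: "A \<in> pattern_algebra \<Longrightarrow> A \<in> carrier_mat n n"
  by (simp add: pattern_algebra_def)

lemma pattern_zero: "0\<^sub>m n n \<in> pattern_algebra"
  by (simp add: pattern_algebra_def)

lemma pattern_unit_mat: "i < n \<Longrightarrow> j < n \<Longrightarrow> R i j \<Longrightarrow> unit_mat n i j \<in> pattern_algebra"
  by (auto simp: pattern_algebra_def unit_entry_def)

lemma pattern_add: "A \<in> pattern_algebra \<Longrightarrow> B \<in> pattern_algebra \<Longrightarrow> A + B \<in> pattern_algebra"
  by (auto simp: pattern_algebra_def)

lemma pattern_diff: "A \<in> pattern_algebra \<Longrightarrow> B \<in> pattern_algebra \<Longrightarrow> A - B \<in> pattern_algebra"
  by (auto simp: pattern_algebra_def)

lemma pattern_smult: "A \<in> pattern_algebra \<Longrightarrow> c \<cdot>\<^sub>m A \<in> pattern_algebra"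
  by (auto simp: pattern_algebra_def)

text \<open>If \<open>R i j\<close> fails, transitivity makes \<open>R i k\<close> or
  \<open>R k j\<close> fail for each \<open>k\<close>, so every summand is zero.\<close>

lemma pattern_mult:
  assumes A: "A \<in> pattern_algebra" and B: "B \<in> pattern_algebra"
  shows "A * B \<in> pattern_algebra"
proof -
  have c: "A \<in> carrier_mat n n" "B \<in> carrier_mat n n" using A B pattern_carrier by auto
  have "(A * B) $$ (i, j) = 0" if ij: "i < n" "j < n" "\<not> R i j" for i j
  proof -
    have "A $$ (i, k) * B $$ (k, j) = 0" if "k < n" for k
    proof (cases "R i k")
      case True
      then have "\<not> R k j" using trans_R[OF ij(1) that ij(2)] ij(3) by blast
      then show ?thesis using B ij that by (simp add: pattern_algebra_def)
    next
      case False
      then show ?thesis using A ij that by (simp add: pattern_algebra_def)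
    qed
    then show ?thesis using c ij by (simp add: scalar_prod_def)
  qed
  then show ?thesis using c by (simp add: pattern_algebra_def del: index_mult_mat(1))
qed

lemma pattern_lie_bracket:
  "A \<in> pattern_algebra \<Longrightarrow> B \<in> pattern_algebra \<Longrightarrow> lie_bracket A B \<in> pattern_algebra"
  unfolding lie_bracket_def by (intro pattern_diff pattern_mult)

text \<open>The units in the pattern span the algebra. The induction runs over a finite set of
  positions outside which \<open>x\<close> vanishes.\<close>

lemma pattern_induct [consumes 1, case_names zero add]:
  assumes x: "x \<in> pattern_algebra"
    and zero: "P (0\<^sub>m n n)"
    and add: "\<And>x i j c. x \<in> pattern_algebra \<Longrightarrow> P x \<Longrightarrow> i < n \<Longrightarrow> j < n \<Longrightarrow> R i j \<Longrightarrow>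
      P (x + c \<cdot>\<^sub>m unit_mat n i j)"
  shows "P x"
proof -
  have "P x" if "finite T" "x \<in> pattern_algebra"
    "\<forall>p<n. \<forall>q<n. (p, q) \<notin> T \<longrightarrow> x $$ (p, q) = 0" for T x
    using that
  proof (induction T arbitrary: x rule: finite_induct)
    case empty
    then have "x = 0\<^sub>m n n" using pattern_carrier by (intro eq_matI) auto
    then show ?case using zero by simp
  next
    case (insert t T)
    obtain i j where t: "t = (i, j)" by fastforce
    show ?case
    proof (cases "i < n \<and> j < n \<and> R i j")
      case True
      then have ij: "i < n" "j < n" "R i j" by auto
      \<comment> \<open>This is \<open>x\<close> with its \<open>(i, j)\<close> entry
        cleared.\<close>
      define y where "y = x + (- x $$ (i, j)) \<cdot>\<^sub>m unit_mat n i j"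
      have xc: "x \<in> carrier_mat n n" using insert.prems pattern_carrier by blast
      have y: "y \<in> pattern_algebra"
        unfolding y_def using insert.prems pattern_unit_mat[OF ij] by (intro pattern_add pattern_smult)
      have "\<forall>p<n. \<forall>q<n. (p, q) \<notin> T \<longrightarrow> y $$ (p, q) = 0"
        using insert.prems(2) xc by (auto simp: y_def t unit_entry_def unit_mat_def)
      then have "P y" using insert.IH y by blast
      then have "P (y + x $$ (i, j) \<cdot>\<^sub>m unit_mat n i j)" using add y ij by blast
      also have "y + x $$ (i, j) \<cdot>\<^sub>m unit_mat n i j = x"
        using xc by (intro eq_matI) (auto simp: y_def unit_mat_def)
      finally show ?thesis .
    next
      case False
      then have "\<forall>p<n. \<forall>q<n. (p, q) \<notin> T \<longrightarrow> x $$ (p, q) = 0"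
        using insert.prems by (auto simp: pattern_algebra_def t)
      then show ?thesis using insert by blast
    qed
  qed
  from this[of "{..<n} \<times> {..<n}"] show ?thesis using x by simp
qed

lemma scalar_mats_zero: "0\<^sub>m n n \<in> scalar_mats"
  by (simp add: scalar_mats_def scalar_entries_def)

lemma scalar_mats_add_smult:
  assumes "A \<in> scalar_mats" "B \<in> scalar_mats"
  shows "A + c \<cdot>\<^sub>m B \<in> scalar_mats"
proof -
  have c: "A \<in> carrier_mat n n" "B \<in> carrier_mat n n"
    and s: "scalar_entries n (\<lambda>p q. A $$ (p, q))" "scalar_entries n (\<lambda>p q. B $$ (p, q))"
    using assms by (auto simp: scalar_mats_def)
  have "scalar_entries n (\<lambda>p q. (A + c \<cdot>\<^sub>m B) $$ (p, q))"
  proof (rule scalar_entriesI)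
    fix p q assume pq: "p < n" "q < n"
    show "(A + c \<cdot>\<^sub>m B) $$ (p, p) = (A + c \<cdot>\<^sub>m B) $$ (q, q)"
      using scalar_entries_diagD[OF s(1) pq] scalar_entries_diagD[OF s(2) pq] c pq by simp
    show "(A + c \<cdot>\<^sub>m B) $$ (p, q) = 0" if "p \<noteq> q"
      using scalar_entries_offD[OF s(1) pq that] scalar_entries_offD[OF s(2) pq that] c pq by simp
  qed
  then show ?thesis using c by (simp add: scalar_mats_def)
qed

lemma smult_one_center: "c \<cdot>\<^sub>m 1\<^sub>m n \<in> center pattern_algebra"
  unfolding center_def
proof (intro CollectI conjI ballI)
  show "c \<cdot>\<^sub>m 1\<^sub>m n \<in> pattern_algebra"
    using refl_R by (auto simp: pattern_algebra_def)
  fix x :: "'a mat" assume "x \<in> pattern_algebra"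
  then have x: "x \<in> carrier_mat n n" by (rule pattern_carrier)
  show "c \<cdot>\<^sub>m 1\<^sub>m n * x = x * (c \<cdot>\<^sub>m 1\<^sub>m n)"
    unfolding mult_smult_assoc_mat[OF one_carrier_mat x] mult_smult_distrib[OF x one_carrier_mat]
    using x by simp
qed

lemma scalar_mats_center:
  assumes "A \<in> scalar_mats"
  shows "A \<in> center pattern_algebra"
proof -
  have A: "A \<in> carrier_mat n n" and s: "scalar_entries n (\<lambda>p q. A $$ (p, q))"
    using assms by (auto simp: scalar_mats_def)
  define a where "a = A $$ (0, 0)"
  have "A $$ (p, q) = (a \<cdot>\<^sub>m 1\<^sub>m n) $$ (p, q)" if "p < n" "q < n" for p q
    using scalar_entries_offD[OF s that] scalar_entries_diagD[OF s that(1), of 0] that n3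
    by (cases "p = q") (auto simp: a_def)
  then have "A = a \<cdot>\<^sub>m 1\<^sub>m n"
    using A by (intro eq_matI) auto
  then show ?thesis using smult_one_center by simp
qed

lemma linear_diff:
  assumes f: "linear_between pattern_algebra pattern_algebra f" and x: "x \<in> pattern_algebra"
    and y: "y \<in> pattern_algebra"
  shows "f (x - y) = f x - f y"
proof -
  have c: "x \<in> carrier_mat n n" "y \<in> carrier_mat n n" "f x \<in> carrier_mat n n" "f y \<in> carrier_mat n n"
    using f x y pattern_carrier by (auto simp: linear_between_def)
  have "x - y = x + (- 1) \<cdot>\<^sub>m y" using c by (intro eq_matI) auto
  then have "f (x - y) = f x + (- 1) \<cdot>\<^sub>m f y"
    using f x y pattern_smult[OF y, of "- 1"] by (simp add: linear_between_def)
  also have "\<dots> = f x - f y" using c by (intro eq_matI) auto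
  finally show ?thesis .
qed

lemma linear_zero:
  assumes f: "linear_between pattern_algebra pattern_algebra f"
  shows "f (0\<^sub>m n n) = 0\<^sub>m n n"
proof -
  have "f (0\<^sub>m n n) \<in> carrier_mat n n"
    using f pattern_zero pattern_carrier by (auto simp: linear_between_def)
  moreover have "f (0\<^sub>m n n - 0\<^sub>m n n) = f (0\<^sub>m n n) - f (0\<^sub>m n n)"
    by (rule linear_diff[OF f pattern_zero pattern_zero])
  moreover have "(0\<^sub>m n n :: 'a mat) - 0\<^sub>m n n = 0\<^sub>m n n" by (intro eq_matI) auto
  ultimately show ?thesis by (metis minus_r_inv_mat)
qed

lemma linear_scalar:
  assumes f: "linear_between pattern_algebra pattern_algebra f"
    and basis: "\<And>i j. i < n \<Longrightarrow> j < n \<Longrightarrow> R i j \<Longrightarrow> f (unit_mat n i j) \<in> scalar_mats"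
    and x: "x \<in> pattern_algebra"
  shows "f x \<in> scalar_mats"
  using x
proof (induction x rule: pattern_induct)
  case zero
  show ?case using linear_zero[OF f] scalar_mats_zero by simp
next
  case (add x i j c)
  note E = pattern_unit_mat[OF add(2-4)]
  have "f (x + c \<cdot>\<^sub>m unit_mat n i j) = f x + f (c \<cdot>\<^sub>m unit_mat n i j)"
    using f add(1) pattern_smult[OF E] unfolding linear_between_def by blast
  moreover have "f (c \<cdot>\<^sub>m unit_mat n i j) = c \<cdot>\<^sub>m f (unit_mat n i j)"
    using f E unfolding linear_between_def by blast
  ultimately show ?case using scalar_mats_add_smult add(5) basis[OF add(2-4)] by simp
qed

text \<open>Evaluation on units turns \<open>f\<close> into a family satisfying
  \<open>lie_der\<close>.\<close>

lemma lie_derivation_inner: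
  assumes f: "linear_between pattern_algebra pattern_algebra f"
    and lie: "\<And>x z. x \<in> pattern_algebra \<Longrightarrow> z \<in> pattern_algebra \<Longrightarrow>
      f (lie_bracket x z) = lie_bracket (f x) z + lie_bracket x (f z)"
  shows "\<exists>m. \<forall>i<n. \<forall>j<n. R i j \<longrightarrow> scalar_entries n (\<lambda>p q. f (unit_mat n i j) $$ (p, q) - unit_bracket i j m p q)"
proof -
  have fp: "f x \<in> pattern_algebra" if "x \<in> pattern_algebra" for x
    using f that by (simp add: linear_between_def)
  have "lie_der (\<lambda>i j p q. f (unit_mat n i j) $$ (p, q))"
    unfolding lie_der_def
  proof (intro conjI allI impI)
    fix i j p q assume "i < n" "j < n" "p < n" "q < n" "R i j" "\<not> R p q"
    then show "f (unit_mat n i j) $$ (p, q) = 0"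
      using fp[OF pattern_unit_mat] by (simp add: pattern_algebra_def)
  next
    fix i j k l p q
    assume a: "i < n" "j < n" "k < n" "l < n" and pq: "p < n" "q < n" and Rs: "R i j" "R k l"
    \<comment> \<open>\<open>X\<close> and \<open>Y\<close> are the two products in the commutator
      of the units; \<open>trans_R\<close> keeps them in the algebra.\<close>
    define X where "X = (if j = k then unit_mat n i l else 0\<^sub>m n n :: 'a mat)"
    define Y where "Y = (if l = i then unit_mat n k j else 0\<^sub>m n n :: 'a mat)"
    have X: "X \<in> pattern_algebra"
      using a Rs trans_R[of i j l] pattern_unit_mat pattern_zero by (auto simp: X_def)
    have Y: "Y \<in> pattern_algebra"
      using a Rs trans_R[of k l j] pattern_unit_mat pattern_zero by (auto simp: Y_def)
    note E = pattern_unit_mat[OF a(1,2) Rs(1)] pattern_unit_mat[OF a(3,4) Rs(2)]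
    have c: "f (unit_mat n i j) \<in> carrier_mat n n" "f (unit_mat n k l) \<in> carrier_mat n n"
      "f X \<in> carrier_mat n n" "f Y \<in> carrier_mat n n"
      using fp E X Y pattern_carrier by auto
    have "f X - f Y =
        lie_bracket (f (unit_mat n i j)) (unit_mat n k l) + lie_bracket (unit_mat n i j) (f (unit_mat n k l))"
      using lie[OF E] linear_diff[OF f X Y]
      unfolding lie_bracket_unit_mat_unit_mat[OF a] X_def Y_def by simp
    then have "(f X - f Y) $$ (p, q) =
        (lie_bracket (f (unit_mat n i j)) (unit_mat n k l) +
          lie_bracket (unit_mat n i j) (f (unit_mat n k l))) $$ (p, q)"
      by simp
    then have "f X $$ (p, q) - f Y $$ (p, q) =
        - unit_bracket k l (\<lambda>p q. f (unit_mat n i j) $$ (p, q)) p q +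
        unit_bracket i j (\<lambda>p q. f (unit_mat n k l) $$ (p, q)) p q"
      using c pq a by (simp add: lie_bracket_unit_mat_index)
    moreover have "f X $$ (p, q) = (if j = k then f (unit_mat n i l) $$ (p, q) else 0)"
      "f Y $$ (p, q) = (if l = i then f (unit_mat n k j) $$ (p, q) else 0)"
      using linear_zero[OF f] pq by (auto simp: X_def Y_def)
    ultimately show "unit_bracket i j (\<lambda>p q. f (unit_mat n k l) $$ (p, q)) p q -
        unit_bracket k l (\<lambda>p q. f (unit_mat n i j) $$ (p, q)) p q =
        (if j = k then f (unit_mat n i l) $$ (p, q) else 0) -
        (if l = i then f (unit_mat n k j) $$ (p, q) else 0)"
      by simp
  qed
  from lie_der_inner[OF this] show ?thesis .
qed

end

section \<open>Lie biderivations of the pattern algebra\<close>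

context incidence_preorder
begin

lemma bilinear_diff:
  assumes f: "bilinear_between pattern_algebra pattern_algebra f"
    and g: "bilinear_between pattern_algebra pattern_algebra g"
  shows "bilinear_between pattern_algebra pattern_algebra (\<lambda>x y. f x y - g x y)"
proof -
  have lin: "linear_between pattern_algebra pattern_algebra (\<lambda>x. f x - g x)"
    if f: "linear_between pattern_algebra pattern_algebra f"
      and g: "linear_between pattern_algebra pattern_algebra g"
    for f g :: "'a mat \<Rightarrow> 'a mat"
    unfolding linear_between_def
  proof (intro conjI ballI allI)
    fix x :: "'a mat" assume x: "x \<in> pattern_algebra"
    have fg: "f x \<in> pattern_algebra" "g x \<in> pattern_algebra"
      using f g x by (auto simp: linear_between_def)
    then show "f x - g x \<in> pattern_algebra" by (rule pattern_diff)
    have c: "f x \<in> carrier_mat n n" "g x \<in> carrier_mat n n" using fg pattern_carrier by auto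
    have "f (c \<cdot>\<^sub>m x) = c \<cdot>\<^sub>m f x" "g (c \<cdot>\<^sub>m x) = c \<cdot>\<^sub>m g x" for c
      using f g x by (auto simp: linear_between_def)
    then show "f (c \<cdot>\<^sub>m x) - g (c \<cdot>\<^sub>m x) = c \<cdot>\<^sub>m (f x - g x)" for c
      using c by (auto intro!: eq_matI simp: algebra_simps)
    fix y :: "'a mat" assume y: "y \<in> pattern_algebra"
    have c': "f y \<in> carrier_mat n n" "g y \<in> carrier_mat n n"
      using f g y pattern_carrier by (auto simp: linear_between_def)
    have "f (x + y) = f x + f y" "g (x + y) = g x + g y"
      using f g x y by (auto simp: linear_between_def)
    then show "f (x + y) - g (x + y) = (f x - g x) + (f y - g y)"
      using c c' by (auto intro!: eq_matI)
  qed
  then show ?thesis using f g unfolding bilinear_between_def by blast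
qed

lemma linear_lie_bracket:
  assumes b: "b \<in> pattern_algebra"
  shows "linear_between pattern_algebra pattern_algebra (\<lambda>x. lie_bracket x b)"
    and "linear_between pattern_algebra pattern_algebra (lie_bracket b)"
proof -
  show "linear_between pattern_algebra pattern_algebra (\<lambda>x. lie_bracket x b)"
    unfolding linear_between_def
    by (intro conjI ballI allI pattern_lie_bracket lie_bracket_add(1)[of _ n]
        lie_bracket_smult(1)[of _ n] pattern_carrier b)
  show "linear_between pattern_algebra pattern_algebra (lie_bracket b)"
    unfolding linear_between_def
    by (intro conjI ballI allI pattern_lie_bracket lie_bracket_add(2)[of _ n]
        lie_bracket_smult(2)[of _ n] pattern_carrier b)
qed

lemma linear_comp:
  assumes "linear_between pattern_algebra pattern_algebra f"
    and "linear_between pattern_algebra pattern_algebra g"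
  shows "linear_between pattern_algebra pattern_algebra (\<lambda>x. f (g x))"
  using assms unfolding linear_between_def by simp

lemma bilinear_extremal:
  assumes a: "a \<in> pattern_algebra"
  shows "bilinear_between pattern_algebra pattern_algebra (\<lambda>x y. lie_bracket x (lie_bracket y a))"
  unfolding bilinear_between_def
  using linear_lie_bracket(1) pattern_lie_bracket[OF _ a]
    linear_comp[OF linear_lie_bracket(2) linear_lie_bracket(1)[OF a]] by blast

lemma linear_smult:
  "linear_between pattern_algebra pattern_algebra (\<lambda>x. c \<cdot>\<^sub>m x)"
  unfolding linear_between_def
proof (intro conjI ballI allI pattern_smult)
  fix x y :: "'a mat" and d :: 'a assume x: "x \<in> pattern_algebra"
  show "c \<cdot>\<^sub>m (d \<cdot>\<^sub>m x) = d \<cdot>\<^sub>m (c \<cdot>\<^sub>m x)"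
    by (intro eq_matI) (simp_all add: mult.left_commute)
  assume "y \<in> pattern_algebra"
  then show "c \<cdot>\<^sub>m (x + y) = c \<cdot>\<^sub>m x + c \<cdot>\<^sub>m y"
    using pattern_carrier[OF x] pattern_carrier by (intro add_smult_distrib_left_mat)
qed

lemma bilinear_inner:
  "bilinear_between pattern_algebra pattern_algebra (\<lambda>x y. c \<cdot>\<^sub>m lie_bracket x y)"
  unfolding bilinear_between_def
  using linear_comp[OF linear_smult linear_lie_bracket(1)]
    linear_comp[OF linear_smult linear_lie_bracket(2)] by blast

lemma extremal_summand_lie_bracket:
  assumes a: "a \<in> pattern_algebra"
  shows "extremal_summand pattern_algebra (\<lambda>x y. lie_bracket x (lie_bracket y a))"
proof (cases "a \<in> center pattern_algebra")
  case True
  have "lie_bracket x (lie_bracket y a) = 0\<^sub>m (dim_row x) (dim_col x)"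
    if x: "x \<in> pattern_algebra" and y: "y \<in> pattern_algebra" for x y
  proof -
    have "a * y = y * a" using True y by (auto simp: center_def)
    then have "lie_bracket y a = 0\<^sub>m n n"
      using pattern_carrier[OF a] pattern_carrier[OF y] by (simp add: lie_bracket_def)
    then show ?thesis using lie_bracket_zero pattern_carrier[OF x] by auto
  qed
  then show ?thesis unfolding extremal_summand_def by blast
next
  case False
  then show ?thesis
    unfolding extremal_summand_def extremal_biderivation_def using bilinear_extremal a by blast
qed

text \<open>The central factor is the scalar matrix with diagonal \<open>c\<close>.\<close>

lemma inner_biderivation_smult:
  "inner_biderivation pattern_algebra (\<lambda>x y. c \<cdot>\<^sub>m lie_bracket x y)"
  unfolding inner_biderivation_def
proof (intro bexI[of _ "c \<cdot>\<^sub>m 1\<^sub>m n"] ballI smult_one_center)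
  fix x y :: "'a mat" assume "x \<in> pattern_algebra" "y \<in> pattern_algebra"
  then have "lie_bracket x y \<in> carrier_mat n n" by (intro lie_bracket_carrier pattern_carrier)
  then show "c \<cdot>\<^sub>m lie_bracket x y = c \<cdot>\<^sub>m 1\<^sub>m n * lie_bracket x y"
    by (simp only: mult_smult_assoc_mat[OF one_carrier_mat] left_mult_one_mat)
qed

lemma unit_bracket_add:
  "unit_bracket i j (\<lambda>p q. A p q + B p q) p q =
   unit_bracket i j A p q + unit_bracket i j B p q"
  by (simp add: unit_bracket_def)

lemma unit_bracket_cong:
  "(\<And>p q. p < n \<Longrightarrow> q < n \<Longrightarrow> A p q = B p q) \<Longrightarrow> i < n \<Longrightarrow> j < n \<Longrightarrow> p < n \<Longrightarrow> q < n \<Longrightarrow>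
    unit_bracket i j A p q = unit_bracket i j B p q"
  by (simp add: unit_bracket_def)

lemma scalar_entries_diff:
  assumes "scalar_entries n A" "scalar_entries n B"
  shows "scalar_entries n (\<lambda>p q. A p q - B p q)"
proof (rule scalar_entriesI)
  fix p q assume pq: "p < n" "q < n"
  show "A p p - B p p = A q q - B q q"
    by (simp only: scalar_entries_diagD[OF assms(1) pq] scalar_entries_diagD[OF assms(2) pq])
  show "A p q - B p q = 0" if "p \<noteq> q"
    by (simp add: scalar_entries_offD[OF assms(1) pq that] scalar_entries_offD[OF assms(2) pq that])
qed

lemma scalar_entries_cong:
  assumes "scalar_entries n A" and "\<And>p q. p < n \<Longrightarrow> q < n \<Longrightarrow> B p q = A p q"
  shows "scalar_entries n B"
proof (rule scalar_entriesI)
  fix p q assume pq: "p < n" "q < n"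
  show "B p p = B q q"
    unfolding assms(2)[OF pq(1,1)] assms(2)[OF pq(2,2)] by (rule scalar_entries_diagD[OF assms(1) pq])
  show "B p q = 0" if "p \<noteq> q"
    unfolding assms(2)[OF pq] by (rule scalar_entries_offD[OF assms(1) pq that])
qed

text \<open>Fixing either argument at a unit yields a Lie derivation in the other. The matrices
  describing them satisfy \<open>exchange\<close>, because both brackets are congruent to the same
  value of \<open>\<phi>\<close>.\<close>

lemma lie_biderivation_basis:
  fixes \<phi> :: "'a::comm_ring_1 mat \<Rightarrow> 'a mat \<Rightarrow> 'a mat"
  assumes \<phi>: "lie_biderivation pattern_algebra \<phi>"
  shows "\<exists>c a. \<forall>i<n. \<forall>j<n. \<forall>k<n. \<forall>l<n. R i j \<longrightarrow> R k l \<longrightarrow>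
      scalar_entries n (\<lambda>p q. \<phi> (unit_mat n i j) (unit_mat n k l) $$ (p, q) -
        unit_bracket i j (\<lambda>p q. c * unit_entry k l p q +
          unit_bracket k l (\<lambda>p q. a * unit_entry 0 (n - 1) p q) p q) p q)"
proof -
  define F where "F i j k l p q = \<phi> (unit_mat n i j) (unit_mat n k l) $$ (p, q)" for i j k l p q
  have lin: "linear_between pattern_algebra pattern_algebra (\<lambda>x. \<phi> x y)"
    "linear_between pattern_algebra pattern_algebra (\<phi> y)" if "y \<in> pattern_algebra" for y
    using \<phi> that unfolding lie_biderivation_def bilinear_between_def by blast+
  have lie: "\<phi> (lie_bracket x z) y = lie_bracket (\<phi> x y) z + lie_bracket x (\<phi> z y)"
    "\<phi> y (lie_bracket x z) = lie_bracket (\<phi> y x) z + lie_bracket x (\<phi> y z)"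
    if "x \<in> pattern_algebra" "y \<in> pattern_algebra" "z \<in> pattern_algebra" for x y z
    using \<phi> that unfolding lie_biderivation_def by blast+
  \<comment> \<open>The inner matrix exists for each unit \<open>(k, l)\<close> separately;
    \<open>SOME\<close> makes a simultaneous choice.\<close>
  define M where "M k l = (SOME m. \<forall>i<n. \<forall>j<n. R i j \<longrightarrow>
      scalar_entries n (\<lambda>p q. F i j k l p q - unit_bracket i j m p q))" for k l
  have M: "scalar_entries n (\<lambda>p q. F i j k l p q - unit_bracket i j (M k l) p q)"
    if a: "i < n" "j < n" "k < n" "l < n" "R i j" "R k l" for i j k l
  proof -
    have E: "unit_mat n k l \<in> pattern_algebra" by (rule pattern_unit_mat[OF a(3,4,6)])
    have "\<exists>m. \<forall>i<n. \<forall>j<n. R i j \<longrightarrow> scalar_entries n (\<lambda>p q. F i j k l p q - unit_bracket i j m p q)"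
      unfolding F_def by (rule lie_derivation_inner[OF lin(1)[OF E] lie(1)[OF _ E]])
    from someI_ex[OF this] show ?thesis unfolding M_def using a by simp
  qed
  define M' where "M' i j = (SOME m. \<forall>k<n. \<forall>l<n. R k l \<longrightarrow>
      scalar_entries n (\<lambda>p q. F i j k l p q - unit_bracket k l m p q))" for i j
  have M': "scalar_entries n (\<lambda>p q. F i j k l p q - unit_bracket k l (M' i j) p q)"
    if a: "i < n" "j < n" "k < n" "l < n" "R i j" "R k l" for i j k l
  proof -
    have E: "unit_mat n i j \<in> pattern_algebra" by (rule pattern_unit_mat[OF a(1,2,5)])
    have "\<exists>m. \<forall>k<n. \<forall>l<n. R k l \<longrightarrow> scalar_entries n (\<lambda>p q. F i j k l p q - unit_bracket k l m p q)"
      unfolding F_def by (rule lie_derivation_inner[OF lin(2)[OF E] lie(2)[OF _ E]])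
    from someI_ex[OF this] show ?thesis unfolding M'_def using a by simp
  qed
  have "exchange M M'"
    unfolding exchange_def
  proof (intro allI impI)
    fix i j k l assume a: "i < n" "j < n" "k < n" "l < n" "R i j" "R k l"
    show "scalar_entries n (\<lambda>p q. unit_bracket i j (M k l) p q - unit_bracket k l (M' i j) p q)"
      using scalar_entries_diff[OF M'[OF a] M[OF a]] by simp
  qed
  then obtain c a where sol: "\<And>k l. k < n \<Longrightarrow> l < n \<Longrightarrow> R k l \<Longrightarrow>
      scalar_entries n (\<lambda>p q. M k l p q - c * unit_entry k l p q -
        unit_bracket k l (\<lambda>p q. a * unit_entry 0 (n - 1) p q) p q)"
    using exchange_solution by blast
  show ?thesis
  proof (rule exI[of _ c], rule exI[of _ a], intro allI impI)
    fix i j k l assume a: "i < n" "j < n" "k < n" "l < n" "R i j" "R k l"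
    \<comment> \<open>\<open>M k l\<close> differs from its normal form by a scalar matrix, and the
      bracket does not see that difference.\<close>
    have "unit_bracket i j (M k l) p q =
        unit_bracket i j (\<lambda>p q. c * unit_entry k l p q +
          unit_bracket k l (\<lambda>p q. a * unit_entry 0 (n - 1) p q) p q) p q"
      if pq: "p < n" "q < n" for p q
    proof -
      have "unit_bracket i j (\<lambda>p q. M k l p q -
          (c * unit_entry k l p q + unit_bracket k l (\<lambda>p q. a * unit_entry 0 (n - 1) p q) p q)) p q = 0"
        using unit_bracket_scalar[OF sol[OF a(3,4,6)] a(1,2) pq] by (simp only: diff_diff_eq)
      then show ?thesis unfolding unit_bracket_diff by simp
    qed
    then show "scalar_entries n (\<lambda>p q. \<phi> (unit_mat n i j) (unit_mat n k l) $$ (p, q) -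
        unit_bracket i j (\<lambda>p q. c * unit_entry k l p q +
          unit_bracket k l (\<lambda>p q. a * unit_entry 0 (n - 1) p q) p q) p q)"
      using M[OF a] by (elim scalar_entries_cong) (simp add: F_def)
  qed
qed

text \<open>The central part \<open>\<kappa>\<close> is simply the remainder. It is bilinear and
  scalar on pairs of units, hence scalar everywhere.\<close>

theorem lie_biderivation_decomposition:
  fixes \<phi> :: "'a::comm_ring_1 mat \<Rightarrow> 'a mat \<Rightarrow> 'a mat"
  assumes \<phi>: "lie_biderivation pattern_algebra \<phi>"
  shows "\<exists>\<epsilon> \<iota> \<kappa>. extremal_summand pattern_algebra \<epsilon> \<and> inner_biderivation pattern_algebra \<iota> \<and>
    central_mapping pattern_algebra \<kappa> \<and>
    (\<forall>x\<in>pattern_algebra. \<forall>y\<in>pattern_algebra. \<phi> x y = \<epsilon> x y + \<iota> x y + \<kappa> x y)"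
proof -
  obtain c a where ca: "\<forall>i<n. \<forall>j<n. \<forall>k<n. \<forall>l<n. R i j \<longrightarrow> R k l \<longrightarrow>
      scalar_entries n (\<lambda>p q. \<phi> (unit_mat n i j) (unit_mat n k l) $$ (p, q) -
        unit_bracket i j (\<lambda>p q. c * unit_entry k l p q +
          unit_bracket k l (\<lambda>p q. a * unit_entry 0 (n - 1) p q) p q) p q)"
    using lie_biderivation_basis[OF \<phi>] by (elim exE)
  define A where "A = a \<cdot>\<^sub>m unit_mat n 0 (n - 1)"
  define \<epsilon> where "\<epsilon> x y = lie_bracket x (lie_bracket y A)" for x y
  define \<iota> where "\<iota> x y = c \<cdot>\<^sub>m lie_bracket x y" for x y
  define \<kappa> where "\<kappa> x y = \<phi> x y - \<epsilon> x y - \<iota> x y" for x y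
  have A: "A \<in> pattern_algebra"
    unfolding A_def using n3 le_R by (intro pattern_smult pattern_unit_mat) auto
  have bil: "bilinear_between pattern_algebra pattern_algebra \<phi>"
    using \<phi> by (simp add: lie_biderivation_def)
  have \<phi>_carrier: "\<phi> x y \<in> carrier_mat n n" if "x \<in> pattern_algebra" "y \<in> pattern_algebra" for x y
    by (rule pattern_carrier) (use bil that in \<open>simp add: bilinear_between_def linear_between_def\<close>)
  have "bilinear_between pattern_algebra pattern_algebra \<kappa>"
    unfolding \<kappa>_def[abs_def] \<epsilon>_def \<iota>_def
    by (intro bilinear_diff bil bilinear_extremal bilinear_inner A)
  then have lin: "linear_between pattern_algebra pattern_algebra (\<lambda>x. \<kappa> x y)"
    "linear_between pattern_algebra pattern_algebra (\<kappa> y)" if "y \<in> pattern_algebra" for y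
    using that unfolding bilinear_between_def by blast+
  have basis: "\<kappa> (unit_mat n i j) (unit_mat n k l) \<in> scalar_mats"
    if a: "i < n" "j < n" "k < n" "l < n" "R i j" "R k l" for i j k l
  proof -
    have E: "unit_mat n i j \<in> (pattern_algebra :: 'a mat set)"
      "unit_mat n k l \<in> (pattern_algebra :: 'a mat set)"
      using pattern_unit_mat a by auto
    define B where "B = lie_bracket (unit_mat n k l) A"
    have Bc: "B \<in> carrier_mat n n"
      unfolding B_def by (intro lie_bracket_carrier unit_mat_carrier pattern_carrier A)
    have B: "B $$ (p, q) = unit_bracket k l (\<lambda>p q. a * unit_entry 0 (n - 1) p q) p q" if "p < n" "q < n" for p q
      unfolding B_def lie_bracket_unit_mat_index(1)[OF pattern_carrier[OF A] a(3,4) that]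
      by (rule unit_bracket_cong[OF _ a(3,4) that]) (simp add: A_def)
    have "\<kappa> (unit_mat n i j) (unit_mat n k l) \<in> pattern_algebra"
      using lin(2)[OF E(1)] E by (simp add: linear_between_def)
    moreover have "\<kappa> (unit_mat n i j) (unit_mat n k l) $$ (p, q) =
        \<phi> (unit_mat n i j) (unit_mat n k l) $$ (p, q) -
        unit_bracket i j (\<lambda>p q. c * unit_entry k l p q +
          unit_bracket k l (\<lambda>p q. a * unit_entry 0 (n - 1) p q) p q) p q"
      if pq: "p < n" "q < n" for p q
    proof -
      have outer: "lie_bracket (unit_mat n i j) B $$ (p, q) =
          unit_bracket i j (\<lambda>p q. unit_bracket k l (\<lambda>p q. a * unit_entry 0 (n - 1) p q) p q) p q"
        unfolding lie_bracket_unit_mat_index(1)[OF Bc a(1,2) pq]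
        by (rule unit_bracket_cong[OF _ a(1,2) pq]) (rule B)
      have inner: "lie_bracket (unit_mat n i j) (unit_mat n k l) $$ (p, q) = unit_bracket i j (unit_entry k l) p q"
        unfolding lie_bracket_unit_mat_index(1)[OF unit_mat_carrier a(1,2) pq]
        by (rule unit_bracket_cong[OF _ a(1,2) pq]) simp
      have "\<kappa> (unit_mat n i j) (unit_mat n k l) $$ (p, q) = \<phi> (unit_mat n i j) (unit_mat n k l) $$ (p, q) -
          lie_bracket (unit_mat n i j) B $$ (p, q) - c * lie_bracket (unit_mat n i j) (unit_mat n k l) $$ (p, q)"
        using \<phi>_carrier[OF E] Bc pq by (simp add: \<kappa>_def \<epsilon>_def \<iota>_def flip: B_def)
      then show ?thesis
        unfolding outer inner by (simp add: unit_bracket_add unit_bracket_scale[of i j c "unit_entry k l"])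
    qed
    then have "scalar_entries n (\<lambda>p q. \<kappa> (unit_mat n i j) (unit_mat n k l) $$ (p, q))"
      by (intro scalar_entries_cong[OF ca[rule_format, OF a]])
    ultimately show ?thesis by (simp add: scalar_mats_def pattern_carrier)
  qed
  \<comment> \<open>Linearity extends scalar values from units first in the left argument, then in
    the right one.\<close>
  have "\<kappa> x (unit_mat n k l) \<in> scalar_mats" if "x \<in> pattern_algebra" "k < n" "l < n" "R k l" for x k l
    by (rule linear_scalar[OF lin(1)[OF pattern_unit_mat[OF that(2-4)]] basis that(1)]) (use that in auto)
  then have "\<kappa> x y \<in> scalar_mats" if "x \<in> pattern_algebra" "y \<in> pattern_algebra" for x y
    using linear_scalar[OF lin(2)[OF that(1)] _ that(2)] that(1) by blast
  then have \<kappa>_center: "\<kappa> x y \<in> center pattern_algebra"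
    if "x \<in> pattern_algebra" "y \<in> pattern_algebra" for x y
    using scalar_mats_center that by blast
  have "central_mapping pattern_algebra \<kappa>"
    using lin \<kappa>_center
    unfolding central_mapping_def bilinear_between_def linear_between_def by simp
  moreover have "\<phi> x y = \<epsilon> x y + \<iota> x y + \<kappa> x y"
    if xy: "x \<in> pattern_algebra" "y \<in> pattern_algebra" for x y
  proof -
    have "\<epsilon> x y \<in> carrier_mat n n" "\<iota> x y \<in> carrier_mat n n"
      using pattern_carrier[OF xy(1)] pattern_carrier[OF xy(2)] pattern_carrier[OF A]
      by (simp_all add: \<epsilon>_def \<iota>_def)
    then show ?thesis using \<phi>_carrier[OF xy] by (intro eq_matI) (auto simp: \<kappa>_def)
  qed
  moreover have "extremal_summand pattern_algebra \<epsilon>"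
    using extremal_summand_lie_bracket[OF A] unfolding \<epsilon>_def[abs_def] .
  moreover have "inner_biderivation pattern_algebra \<iota>"
    using inner_biderivation_smult unfolding \<iota>_def[abs_def] .
  ultimately show ?thesis by blast
qed

text \<open>The Leibniz rule for \<open>x * z\<close> and \<open>z * x\<close> gives the commutator
  rule in each argument.\<close>

lemma biderivation_lie_biderivation:
  fixes \<phi> :: "'a::comm_ring_1 mat \<Rightarrow> 'a mat \<Rightarrow> 'a mat"
  assumes \<phi>: "biderivation pattern_algebra \<phi>"
  shows "lie_biderivation pattern_algebra \<phi>"
proof -
  have der: "d (lie_bracket x z) = lie_bracket (d x) z + lie_bracket x (d z)"
    if d: "derivation pattern_algebra d" and xz: "x \<in> pattern_algebra" "z \<in> pattern_algebra"
    for d :: "'a mat \<Rightarrow> 'a mat" and x z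
  proof -
    have lin: "linear_between pattern_algebra pattern_algebra d"
      and prod: "d (x * z) = d x * z + x * d z" "d (z * x) = d z * x + z * d x"
      using d xz unfolding derivation_def by blast+
    have c: "x \<in> carrier_mat n n" "z \<in> carrier_mat n n" "d x \<in> carrier_mat n n" "d z \<in> carrier_mat n n"
      using lin xz pattern_carrier by (auto simp: linear_between_def)
    have "d (lie_bracket x z) = d (x * z) - d (z * x)"
      unfolding lie_bracket_def by (rule linear_diff[OF lin pattern_mult[OF xz] pattern_mult[OF xz(2,1)]])
    also have "\<dots> = lie_bracket (d x) z + lie_bracket x (d z)"
      unfolding prod lie_bracket_def using c
      by (intro eq_matI) (simp_all del: index_mult_mat(1))
    finally show ?thesis .
  qed
  show ?thesis
    unfolding lie_biderivation_def
  proof (intro conjI ballI)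
    show "bilinear_between pattern_algebra pattern_algebra \<phi>"
      using \<phi> by (simp add: biderivation_def)
    fix x y z :: "'a mat"
    assume xyz: "x \<in> pattern_algebra" "y \<in> pattern_algebra" "z \<in> pattern_algebra"
    have "derivation pattern_algebra (\<lambda>x. \<phi> x y)" "derivation pattern_algebra (\<phi> x)"
      using \<phi> xyz unfolding biderivation_def by blast+
    then show "\<phi> (lie_bracket x z) y = lie_bracket (\<phi> x y) z + lie_bracket x (\<phi> z y)"
      and "\<phi> x (lie_bracket y z) = lie_bracket (\<phi> x y) z + lie_bracket y (\<phi> x z)"
      using der xyz by blast+
  qed
qed

end

section \<open>Block and plain upper triangular matrices as pattern algebras\<close>

lemma block_indices_cover:
  assumes "j < sum_list ks"
  shows "\<exists>t<length ks. j \<in> block_indices ks t"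
proof -
  have "\<exists>t<m. j \<in> block_indices ks t" if "j < sum_list (take m ks)" "m \<le> length ks" for m
    using that
  proof (induction m)
    case (Suc m)
    then show ?case
      by (cases "j < sum_list (take m ks)") (auto simp: block_indices_def less_Suc_eq)
  qed simp
  from this[of "length ks"] show ?thesis using assms by simp
qed

lemma sum_list_take_mono: "r \<le> s \<Longrightarrow> sum_list (take r ks) \<le> sum_list (take s (ks :: nat list))"
  by (metis le_add1 le_add_diff_inverse sum_list_append take_add)

lemma block_indices_less:
  assumes "s < r" "i \<in> block_indices ks r" "j \<in> block_indices ks s"
  shows "j < i"
  using assms sum_list_take_mono[of "Suc s" r ks] by (auto simp: block_indices_def)

text \<open>The negation of the condition that forces a zero, so the patterns match directly. On
  indices in range it says that the block of \<open>i\<close> does not come after the block of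
  \<open>j\<close>.\<close>

definition block_le :: "nat list \<Rightarrow> nat \<Rightarrow> nat \<Rightarrow> bool" where
  "block_le ks i j \<longleftrightarrow>
     \<not> (\<exists>r<length ks. \<exists>s<r. i \<in> block_indices ks r \<and> j \<in> block_indices ks s)"

text \<open>For transitivity, let \<open>t\<close> be the block of \<open>j\<close>. Were
  \<open>i\<close> in a later block \<open>r\<close> than the block \<open>s\<close> of
  \<open>k\<close>, then \<open>s < t\<close> would contradict \<open>block_le ks j k\<close>, and
  \<open>t \<le> s\<close> would give \<open>t < r\<close>, against
  \<open>block_le ks i j\<close>.\<close>

lemma incidence_preorder_block:
  assumes "3 \<le> sum_list ks"
  shows "incidence_preorder (sum_list ks) (block_le ks)"
proof
  show "3 \<le> sum_list ks" by (rule assms)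
  show "block_le ks i j" if "i \<le> j" for i j
    using that block_indices_less unfolding block_le_def by (meson linorder_not_less)
  fix i j k assume j: "j < sum_list ks" and ij: "block_le ks i j" and jk: "block_le ks j k"
  obtain t where t: "t < length ks" "j \<in> block_indices ks t" using block_indices_cover[OF j] by blast
  show "block_le ks i k"
    unfolding block_le_def
  proof clarify
    fix r s assume rs: "r < length ks" "s < r" "i \<in> block_indices ks r" "k \<in> block_indices ks s"
    show False
    proof (cases "s < t")
      case True
      then show ?thesis using jk t rs unfolding block_le_def by blast
    next
      case False
      then have "t < r" using rs by simp
      then show ?thesis using ij t rs unfolding block_le_def by blast
    qed
  qed
qed

lemma pattern_algebra_block:
  assumes "3 \<le> sum_list ks"
  shows "incidence_preorder.pattern_algebra (sum_list ks) (block_le ks) =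
    (block_upper_triangular_algebra ks :: 'a::comm_ring_1 mat set)"
proof -
  interpret incidence_preorder "sum_list ks" "block_le ks"
    by (rule incidence_preorder_block[OF assms])
  have bound: "i < sum_list ks" if "r < length ks" "i \<in> block_indices ks r" for r i
  proof -
    have "i < sum_list (take (Suc r) ks)" using that(2) by (simp add: block_indices_def)
    also have "\<dots> \<le> sum_list (take (length ks) ks)"
      using that(1) by (intro sum_list_take_mono) simp
    finally show ?thesis by simp
  qed
  show ?thesis
  proof (intro equalityI subsetI)
    fix A :: "'a mat" assume "A \<in> pattern_algebra"
    then have A: "A \<in> carrier_mat (sum_list ks) (sum_list ks)"
      and z: "\<And>i j. i < sum_list ks \<Longrightarrow> j < sum_list ks \<Longrightarrow> \<not> block_le ks i j \<Longrightarrow> A $$ (i, j) = 0"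
      by (auto simp: pattern_algebra_def)
    have "A $$ (i, j) = 0"
      if "r < length ks" "s < r" "i \<in> block_indices ks r" "j \<in> block_indices ks s" for r s i j
    proof (rule z)
      show "i < sum_list ks" "j < sum_list ks"
        using bound[of r i] bound[of s j] that by auto
      show "\<not> block_le ks i j" using that unfolding block_le_def by blast
    qed
    then show "A \<in> block_upper_triangular_algebra ks"
      using A unfolding block_upper_triangular_algebra_def by blast
  next
    fix A :: "'a mat" assume "A \<in> block_upper_triangular_algebra ks"
    then show "A \<in> pattern_algebra"
      unfolding block_upper_triangular_algebra_def pattern_algebra_def block_le_def by blast
  qed
qed

lemma incidence_preorder_le:
  "3 \<le> n \<Longrightarrow> incidence_preorder n (\<le>)"
  by unfold_locales auto

lemma pattern_algebra_le:
  assumes "3 \<le> n"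
  shows "incidence_preorder.pattern_algebra n (\<le>) =
    (upper_triangular_algebra n :: 'a::comm_ring_1 mat set)"
proof -
  interpret incidence_preorder n "(\<le>)"
    by (rule incidence_preorder_le[OF assms])
  show ?thesis
    unfolding pattern_algebra_def upper_triangular_algebra_def upper_triangular_def
    by (auto simp: not_le)
qed

theorem corollary3p8:
  fixes n :: nat
  assumes "n \<ge> 3"
  shows
    "(\<forall>ks :: nat list. \<forall>\<phi> :: 'c::idom mat \<Rightarrow> 'c mat \<Rightarrow> 'c mat.
        (\<forall>k\<in>set ks. 0 < k) \<longrightarrow> sum_list ks = n \<longrightarrow>
        lie_biderivation (block_upper_triangular_algebra ks) \<phi> \<longrightarrow>
        (\<exists>\<epsilon> \<iota> \<kappa>.
           extremal_summand (block_upper_triangular_algebra ks) \<epsilon> \<and>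
           inner_biderivation (block_upper_triangular_algebra ks) \<iota> \<and>
           central_mapping (block_upper_triangular_algebra ks) \<kappa> \<and>
           (\<forall>x\<in>block_upper_triangular_algebra ks. \<forall>y\<in>block_upper_triangular_algebra ks.
              \<phi> x y = \<epsilon> x y + \<iota> x y + \<kappa> x y)))
     \<and>
     (\<forall>\<phi> :: 'c mat \<Rightarrow> 'c mat \<Rightarrow> 'c mat.
        biderivation (upper_triangular_algebra n) \<phi> \<longrightarrow>
        (\<exists>\<epsilon> \<iota> \<kappa>.
           extremal_summand (upper_triangular_algebra n) \<epsilon> \<and>
           inner_biderivation (upper_triangular_algebra n) \<iota> \<and>
           central_mapping (upper_triangular_algebra n) \<kappa> \<and>
           (\<forall>x\<in>upper_triangular_algebra n. \<forall>y\<in>upper_triangular_algebra n.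
              \<phi> x y = \<epsilon> x y + \<iota> x y + \<kappa> x y)))"
proof (intro conjI allI impI, goal_cases)
  case (1 ks \<phi>)
  then have n3: "3 \<le> sum_list ks" using assms by simp
  interpret incidence_preorder "sum_list ks" "block_le ks"
    by (rule incidence_preorder_block[OF n3])
  show ?case
    using lie_biderivation_decomposition[of \<phi>] 1 unfolding pattern_algebra_block[OF n3] by blast
next
  case (2 \<phi>)
  interpret incidence_preorder n "(\<le>)"
    by (rule incidence_preorder_le[OF assms])
  show ?case
    using lie_biderivation_decomposition[OF biderivation_lie_biderivation[of \<phi>]] 2
    unfolding pattern_algebra_le[OF assms] by blast
qed

end
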